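(* (Jacobi-Trudi identity.) Let $\lambda,\mu\in\mathcal P$ with $\mu_i\le\lambda_i$ for all $i\in\mathbf N$, and let $l\in\mathbf N$ be such that $\lambda\in\mathbf N^l$ (i.e. $\lambda_i=0$ for all $i\ge l$). Then $$ s_{\lambda/\mu}=\det\bigl(h_{\lambda[i]-\mu[j]}\bigr)_{0\le i,j<l}. $$
   Context: $\mathbf N=\{0,1,2,\ldots\}$. A composition is a finitely supported sequence $\alpha=(\alpha_i)_{i\in\mathbf N}$ of natural numbers; $\mathcal C$ is the set of all compositions, and $\mathcal P\subset\mathcal C$ is the set of partitions, i.e. weakly decreasing compositions. Finite vectors are extended by zeros, so $\mathbf N^n\subset\mathcal C$. For $\alpha\in\mathcal C$ and $i\in\mathbf N$, $\alpha[i]=\alpha_i-1-i\in\mathbf Z$. $\Lambda$ is the ring of symmetric functions over $\mathbf Z$ (symmetric power series of bounded degree in indeterminates $X_i$, $i\in\mathbf N$). For $d\in\mathbf N$, $h_d=\sum_{i_1\le\cdots\le i_d}X_{i_1}\cdots X_{i_d}$ (so $h_0=1$), and $h_d=0$ for $d<0$. Schur functions: for $\alpha\in\mathbf N^n$ put $a_\alpha[X_{[n]}]=\sum_{\sigma\in\mathbf S_n}\operatorname{sgn}(\sigma)\prod_{i=0}^{n-1}X_{\sigma(i)}^{\alpha_i}$, let $\delta_n=(n-1,\ldots,1,0)$, and set $s_\alpha[X_{[n]}]=a_{\delta_n+\alpha}[X_{[n]}]/a_{\delta_n}[X_{[n]}]$ for $\alpha\in\mathbf N^n$ and $s_\alpha[X_{[n]}]=0$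 for $\alpha\in\mathcal C\setminus\mathbf N^n$. Then $s_\alpha\in\Lambda$ is the unique symmetric function which for every $n$ becomes $s_\alpha[X_{[n]}]$ upon setting $X_i=0$ for all $i\ge n$. The set $\{s_\lambda:\lambda\in\mathcal P\}$ is a $\mathbf Z$-basis of $\Lambda$; $\langle\cdot,\cdot\rangle$ is the scalar product on $\Lambda$ for which this basis is orthonormal. The skew Schur function $s_{\lambda/\mu}$ is characterised by $\langle s_{\lambda/\mu},f\rangle=\langle s_\lambda,s_\mu f\rangle$ for all $f\in\Lambda$. *)

theory Defs
  imports
    "HOL-Library.Poly_Mapping"
    "HOL-Library.Multiset"
    "HOL-Combinatorics.Permutations"
    "Jordan_Normal_Form.Determinant"
begin

section \<open>Compositions and partitions\<close>

text \<open>
  Finitely supported sequences of natural numbers serve both as compositions and as exponent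
  vectors of monomials in the indeterminates \<open>X\<^sub>0, X\<^sub>1, \<dots>\<close>.
\<close>

type_synonym composition = "nat \<Rightarrow>\<^sub>0 nat"

abbreviation (input) part :: "composition \<Rightarrow> nat \<Rightarrow> nat" where
  "part \<equiv> Poly_Mapping.lookup"

definition compositions_in :: "nat \<Rightarrow> composition set" where
  "compositions_in n = {\<alpha>. \<forall>i\<ge>n. part \<alpha> i = 0}"

definition partitions :: "composition set" where
  "partitions = {\<alpha>. \<forall>i j. i \<le> j \<longrightarrow> part \<alpha> j \<le> part \<alpha> i}"

definition bracket :: "composition \<Rightarrow> nat \<Rightarrow> int" where
  "bracket \<alpha> i = int (part \<alpha> i) - 1 - int i"

lift_definition staircase :: "nat \<Rightarrow> composition" is
  "\<lambda>n i. if i < n then n - 1 - i else 0"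
  by simp


section \<open>The ring of symmetric functions\<close>

text \<open>
  A formal power series over \<open>\<int>\<close> in the \<open>X\<^sub>i\<close> is given by its coefficient function on exponent
  vectors.
\<close>

type_synonym series = "(nat \<Rightarrow>\<^sub>0 nat) \<Rightarrow> int"

definition total_degree :: "(nat \<Rightarrow>\<^sub>0 nat) \<Rightarrow> nat" where
  "total_degree m = (\<Sum>i\<in>Poly_Mapping.keys m. Poly_Mapping.lookup m i)"

definition bounded_degree :: "series \<Rightarrow> bool" where
  "bounded_degree f \<longleftrightarrow> (\<exists>d. \<forall>m. f m \<noteq> 0 \<longrightarrow> total_degree m \<le> d)"

definition symmetric_series :: "series \<Rightarrow> bool" where
  "symmetric_series f \<longleftrightarrow> (\<forall>\<pi> m. bij \<pi> \<longrightarrow> f (Poly_Mapping.map_key \<pi> m) = f m)"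

definition series_times :: "series \<Rightarrow> series \<Rightarrow> series" where
  "series_times f g m = (\<Sum>(a, b)\<in>{(a, b). a + b = m}. f a * g b)"

lemma total_degree_superset:
  assumes "finite S" "Poly_Mapping.keys m \<subseteq> S"
  shows "total_degree m = (\<Sum>i\<in>S. Poly_Mapping.lookup m i)"
  unfolding total_degree_def using assms
  by (intro sum.mono_neutral_left) (auto simp: in_keys_iff)

lemma total_degree_add: "total_degree (a + b) = total_degree a + total_degree b"
proof -
  let ?S = "Poly_Mapping.keys a \<union> Poly_Mapping.keys b"
  have "total_degree (a + b) = (\<Sum>i\<in>?S. Poly_Mapping.lookup (a + b) i)"
    by (rule total_degree_superset) (auto simp: keys_add)
  also have "\<dots> = (\<Sum>i\<in>?S. Poly_Mapping.lookup a i) + (\<Sum>i\<in>?S. Poly_Mapping.lookup b i)"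
    by (simp add: lookup_add sum.distrib)
  also have "\<dots> = total_degree a + total_degree b"
    by (subst (1 2) total_degree_superset[of ?S]) auto
  finally show ?thesis .
qed

lemma total_degree_0 [simp]: "total_degree 0 = 0"
  by (simp add: total_degree_def)

lemma lookup_le_total_degree: "Poly_Mapping.lookup m i \<le> total_degree m"
proof (cases "i \<in> Poly_Mapping.keys m")
  case True
  then show ?thesis
    unfolding total_degree_def by (intro member_le_sum) auto
next
  case False
  then show ?thesis by (simp add: in_keys_iff)
qed

lemma total_degree_map_key:
  assumes "bij \<pi>"
  shows "total_degree (Poly_Mapping.map_key \<pi> m) = total_degree m"
proof -
  have inj: "inj \<pi>" using assms by (rule bij_is_inj)
  have "total_degree m = (\<Sum>i\<in>\<pi> ` (\<pi> -` Poly_Mapping.keys m). Poly_Mapping.lookup m i)"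
    using assms by (simp add: total_degree_def surj_image_vimage_eq bij_is_surj)
  also have "\<dots> = (\<Sum>i\<in>\<pi> -` Poly_Mapping.keys m. Poly_Mapping.lookup m (\<pi> i))"
    using inj by (subst sum.reindex) (auto intro: inj_on_subset)
  also have "\<dots> = total_degree (Poly_Mapping.map_key \<pi> m)"
    using inj by (simp add: total_degree_def keys_map_key map_key.rep_eq)
  finally show ?thesis by simp
qed

lemma finite_exponents:
  assumes "finite S"
  shows "finite {m :: nat \<Rightarrow>\<^sub>0 nat. Poly_Mapping.keys m \<subseteq> S \<and> total_degree m \<le> d}"
proof (rule finite_imageD)
  let ?A = "{m :: nat \<Rightarrow>\<^sub>0 nat. Poly_Mapping.keys m \<subseteq> S \<and> total_degree m \<le> d}"
  have "Poly_Mapping.lookup ` ?A \<subseteq> {f. \<forall>x. (x \<in> S \<longrightarrow> f x \<in> {..d}) \<and> (x \<notin> S \<longrightarrow> f x = 0)}"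
    by (auto simp: in_keys_iff intro: order_trans[OF lookup_le_total_degree])
  then show "finite (Poly_Mapping.lookup ` ?A)"
    by (rule finite_subset) (rule finite_set_of_finite_funs, use assms in auto)
  show "inj_on Poly_Mapping.lookup ?A"
    by (auto simp: inj_on_def)
qed

lemma finite_decompositions: "finite {(a, b). a + b = (m :: nat \<Rightarrow>\<^sub>0 nat)}"
proof -
  let ?A = "{a :: nat \<Rightarrow>\<^sub>0 nat.
    Poly_Mapping.keys a \<subseteq> Poly_Mapping.keys m \<and> total_degree a \<le> total_degree m}"
  have "{(a, b). a + b = m} \<subseteq> ?A \<times> ?A"
    by (auto simp: total_degree_add in_keys_iff lookup_add)
  moreover have "finite (?A \<times> ?A)"
    by (intro finite_cartesian_product finite_exponents) auto
  ultimately show ?thesis by (rule finite_subset)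
qed

lemma series_times_comm: "series_times f g = series_times g f"
proof
  fix m
  show "series_times f g m = series_times g f m"
    unfolding series_times_def
    by (rule sum.reindex_bij_witness[of _ "\<lambda>(a, b). (b, a)" "\<lambda>(a, b). (b, a)"])
      (auto simp: add.commute mult.commute)
qed

lemma series_times_assoc:
  "series_times (series_times f g) h = series_times f (series_times g h)"
proof
  fix m
  let ?D = "\<lambda>m :: nat \<Rightarrow>\<^sub>0 nat. {(a, b). a + b = m}"
  have "series_times (series_times f g) h m =
      (\<Sum>p\<in>?D m. \<Sum>q\<in>?D (fst p). f (fst q) * g (snd q) * h (snd p))"
    by (simp add: series_times_def case_prod_unfold sum_distrib_right)
  also have "\<dots> = (\<Sum>(p, q)\<in>(SIGMA p:?D m. ?D (fst p)). f (fst q) * g (snd q) * h (snd p))"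
    by (rule sum.Sigma) (auto simp: finite_decompositions)
  also have "\<dots> = (\<Sum>(p, q)\<in>(SIGMA p:?D m. ?D (snd p)). f (fst p) * (g (fst q) * h (snd q)))"
    by (rule sum.reindex_bij_witness[of _
          "\<lambda>((a, b), (c, d)). ((a + c, d), (a, c))" "\<lambda>((a, b), (c, d)). ((c, d + b), (d, b))"])
      (auto simp: add.assoc mult.assoc)
  also have "\<dots> = (\<Sum>p\<in>?D m. \<Sum>q\<in>?D (snd p). f (fst p) * (g (fst q) * h (snd q)))"
    by (rule sum.Sigma[symmetric]) (auto simp: finite_decompositions)
  also have "\<dots> = series_times f (series_times g h) m"
    by (simp add: series_times_def case_prod_unfold sum_distrib_left)
  finally show "series_times (series_times f g) h m = series_times f (series_times g h) m" .
qed

lemma series_times_one: "series_times (\<lambda>m. if m = 0 then 1 else 0) f = f"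
proof
  fix m
  have "series_times (\<lambda>m. if m = 0 then 1 else 0) f m =
      (\<Sum>(a, b)\<in>{(0 :: nat \<Rightarrow>\<^sub>0 nat, m)}. (if a = 0 then 1 else 0) * f b)"
    unfolding series_times_def
    by (intro sum.mono_neutral_right finite_decompositions) (auto split: if_splits)
  then show "series_times (\<lambda>m. if m = 0 then 1 else 0) f m = f m" by simp
qed

lemma series_times_add:
  "series_times (\<lambda>m. f m + g m) h = (\<lambda>m. series_times f h m + series_times g h m)"
  by (auto simp: series_times_def fun_eq_iff case_prod_unfold distrib_right sum.distrib)

lemma bounded_degree_times:
  assumes "bounded_degree f" "bounded_degree g"
  shows "bounded_degree (series_times f g)"
proof -
  from assms obtain d e where
    d: "\<And>m. f m \<noteq> 0 \<Longrightarrow> total_degree m \<le> d" and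
    e: "\<And>m. g m \<noteq> 0 \<Longrightarrow> total_degree m \<le> e"
    unfolding bounded_degree_def by blast
  have "total_degree m \<le> d + e" if nz: "series_times f g m \<noteq> 0" for m
  proof -
    from nz obtain p where p: "p \<in> {(a, b). a + b = m}" "(case p of (a, b) \<Rightarrow> f a * g b) \<noteq> 0"
      unfolding series_times_def by (rule sum.not_neutral_contains_not_neutral)
    then obtain a b where "a + b = m" "f a \<noteq> 0" "g b \<noteq> 0" by (cases p) auto
    then show ?thesis using d e total_degree_add by (metis add_mono)
  qed
  then show ?thesis unfolding bounded_degree_def by blast
qed

lemma symmetric_series_times:
  assumes "symmetric_series f" "symmetric_series g"
  shows "symmetric_series (series_times f g)"
  unfolding symmetric_series_def
proof (intro allI impI)
  fix \<pi> :: "nat \<Rightarrow> nat" and m :: "nat \<Rightarrow>\<^sub>0 nat"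
  assume \<pi>: "bij \<pi>"
  let ?k = "Poly_Mapping.map_key :: (nat \<Rightarrow> nat) \<Rightarrow> (nat \<Rightarrow>\<^sub>0 nat) \<Rightarrow> (nat \<Rightarrow>\<^sub>0 nat)"
  have inj: "inj \<pi>" "inj (inv_into UNIV \<pi>)"
    using \<pi> by (auto simp: bij_is_inj bij_imp_bij_inv)
  have kk: "?k \<pi> (?k (inv_into UNIV \<pi>) a) = a" "?k (inv_into UNIV \<pi>) (?k \<pi> a) = a" for a
    using \<pi> inj
    by (simp_all only: poly_mapping_eq_iff map_key.rep_eq o_assoc[symmetric])
      (simp_all add: bij_is_surj surj_iff[THEN iffD1] inv_o_cancel)
  have "series_times f g (?k \<pi> m) = (\<Sum>(a, b)\<in>{(a, b). a + b = m}. f a * g b)"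
    unfolding series_times_def
  proof (rule sum.reindex_bij_witness[of _ "\<lambda>(a, b). (?k \<pi> a, ?k \<pi> b)"
        "\<lambda>(a, b). (?k (inv_into UNIV \<pi>) a, ?k (inv_into UNIV \<pi>) b)"])
    fix p assume "p \<in> {(a, b). a + b = ?k \<pi> m}"
    then show "(case case p of (a, b) \<Rightarrow> (?k (inv_into UNIV \<pi>) a, ?k (inv_into UNIV \<pi>) b)
          of (a, b) \<Rightarrow> f a * g b) =
        (case p of (a, b) \<Rightarrow> f a * g b)"
      using assms \<pi> by (auto simp: symmetric_series_def bij_imp_bij_inv)
  qed (use inj in \<open>auto simp: kk map_key_plus[symmetric]\<close>)
  then show "series_times f g (?k \<pi> m) = series_times f g m"
    by (simp add: series_times_def)
qed

typedef symfun = "{f :: series. symmetric_series f \<and> bounded_degree f}"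
  morphisms symfun_coeff Abs_symfun
  by (rule exI[of _ "\<lambda>_. 0"]) (auto simp: symmetric_series_def bounded_degree_def)

setup_lifting type_definition_symfun

instantiation symfun :: comm_ring_1
begin

lift_definition zero_symfun :: symfun is "\<lambda>_. 0"
  by (auto simp: symmetric_series_def bounded_degree_def)

lift_definition one_symfun :: symfun is "\<lambda>m. if m = 0 then 1 else 0"
proof
  have *: "Poly_Mapping.map_key \<pi> m = 0 \<longleftrightarrow> m = 0" if "bij \<pi>" for \<pi> :: "nat \<Rightarrow> nat" and m :: "nat \<Rightarrow>\<^sub>0 nat"
  proof -
    have "Poly_Mapping.map_key \<pi> m = 0 \<longleftrightarrow> \<pi> -` Poly_Mapping.keys m = {}"
      using that by (metis keys_map_key keys_eq_empty bij_is_inj)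
    also have "\<dots> \<longleftrightarrow> m = 0"
      using that by (metis bij_is_surj surj_image_vimage_eq vimage_empty image_empty keys_eq_empty)
    finally show ?thesis .
  qed
  show "symmetric_series (\<lambda>m. if m = 0 then 1 else 0)"
    unfolding symmetric_series_def by (metis *)
  show "bounded_degree (\<lambda>m. if m = 0 then 1 else 0)"
    by (auto simp: bounded_degree_def intro!: exI[of _ 0])
qed

lift_definition uminus_symfun :: "symfun \<Rightarrow> symfun" is "\<lambda>f m. - f m"
  by (auto simp: symmetric_series_def bounded_degree_def)

lift_definition plus_symfun :: "symfun \<Rightarrow> symfun \<Rightarrow> symfun" is "\<lambda>f g m. f m + g m"
proof -
  fix f g :: series
  assume *: "symmetric_series f \<and> bounded_degree f" "symmetric_series g \<and> bounded_degree g"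
  then obtain d e where
    "\<And>m. f m \<noteq> 0 \<Longrightarrow> total_degree m \<le> d" "\<And>m. g m \<noteq> 0 \<Longrightarrow> total_degree m \<le> e"
    unfolding bounded_degree_def by blast
  then have "total_degree m \<le> max d e" if "f m + g m \<noteq> 0" for m
    using that by (metis add.right_neutral le_max_iff_disj)
  with * show "symmetric_series (\<lambda>m. f m + g m) \<and> bounded_degree (\<lambda>m. f m + g m)"
    by (auto simp: symmetric_series_def bounded_degree_def)
qed

definition minus_symfun :: "symfun \<Rightarrow> symfun \<Rightarrow> symfun" where
  "minus_symfun f g = f + - g"

lift_definition times_symfun :: "symfun \<Rightarrow> symfun \<Rightarrow> symfun" is series_times
  by (simp add: symmetric_series_times bounded_degree_times)

instance
proof
  fix a b c :: symfun
  show "a + b + c = a + (b + c)" by transfer (simp add: add.assoc)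
  show "a + b = b + a" by transfer (simp add: add.commute)
  show "0 + a = a" by transfer simp
  show "- a + a = 0" by transfer simp
  show "a - b = a + - b" by (simp add: minus_symfun_def)
  show "a * b * c = a * (b * c)" by transfer (simp add: series_times_assoc)
  show "a * b = b * a" by transfer (rule series_times_comm)
  show "1 * a = a" by transfer (rule series_times_one)
  show "(a + b) * c = a * c + b * c" by transfer (rule series_times_add)
  show "(0 :: symfun) \<noteq> 1" by transfer (auto simp: fun_eq_iff)
qed

end


section \<open>Complete homogeneous symmetric functions\<close>

text \<open>
  The coefficient of \<open>X\<^sup>m\<close> in \<open>\<Sum>i\<^sub>1 \<le> \<dots> \<le> i\<^sub>d. X i\<^sub>1 \<cdots> X i\<^sub>d\<close> is the number of weakly increasing
  index sequences whose product of indeterminates is \<open>X\<^sup>m\<close>.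
\<close>

definition monomial_of :: "nat list \<Rightarrow> (nat \<Rightarrow>\<^sub>0 nat)" where
  "monomial_of is = (\<Sum>i\<leftarrow>is. Poly_Mapping.single i 1)"

definition complete_series :: "nat \<Rightarrow> series" where
  "complete_series d m = int (card {is. length is = d \<and> sorted is \<and> monomial_of is = m})"

lemma lookup_monomial_of: "Poly_Mapping.lookup (monomial_of is) = count (mset is)"
  by (induction "is") (auto simp: monomial_of_def lookup_add lookup_single when_def fun_eq_iff)

lemma total_degree_monomial_of: "total_degree (monomial_of is) = length is"
proof (induction "is")
  case Nil
  then show ?case by (simp add: monomial_of_def)
next
  case (Cons i "is")
  have "monomial_of (i # is) = Poly_Mapping.single i 1 + monomial_of is"
    by (simp add: monomial_of_def)
  then show ?case
    using Cons by (simp add: total_degree_add) (simp add: total_degree_def)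
qed

lemma complete_series_eq: "complete_series d m = (if total_degree m = d then 1 else 0)"
proof -
  obtain M where M: "Poly_Mapping.lookup m = count M"
    using Abs_multiset_inverse[of "Poly_Mapping.lookup m"] by (metis CollectI finite_lookup_nat)
  have eq: "monomial_of is = m \<longleftrightarrow> mset is = M" for "is"
    by (metis M count_inject lookup_monomial_of poly_mapping_eq_iff)
  have "total_degree m = size M"
    using eq[of "sorted_list_of_multiset M"] total_degree_monomial_of
    by (metis mset_sorted_list_of_multiset size_mset)
  moreover have "length (sorted_list_of_multiset M) = size M"
    by (metis mset_sorted_list_of_multiset size_mset)
  then have "length is = d \<and> sorted is \<and> monomial_of is = m \<longleftrightarrow>
      is = sorted_list_of_multiset M \<and> size M = d" for "is"
    unfolding eq by (auto simp: sorted_sort_id)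
  then have "{is. length is = d \<and> sorted is \<and> monomial_of is = m} =
      (if size M = d then {sorted_list_of_multiset M} else {})"
    by auto
  ultimately show ?thesis by (simp add: complete_series_def)
qed

lift_definition complete_h :: "int \<Rightarrow> symfun" is
  "\<lambda>d. if d < 0 then (\<lambda>_. 0) else complete_series (nat d)"
proof -
  fix d :: int
  have "symmetric_series (complete_series (nat d))"
    by (simp add: symmetric_series_def complete_series_eq total_degree_map_key)
  moreover have "bounded_degree (complete_series (nat d))"
    unfolding bounded_degree_def complete_series_eq by (rule exI[of _ "nat d"]) simp
  ultimately show "symmetric_series (if d < 0 then (\<lambda>_. 0) else complete_series (nat d)) \<and>
      bounded_degree (if d < 0 then (\<lambda>_. 0) else complete_series (nat d))"
    by (simp add: symmetric_series_def bounded_degree_def)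
qed


section \<open>Schur functions\<close>

text \<open>
  Polynomials in the \<open>X\<^sub>i\<close> over \<open>\<int>\<close>; those in \<open>X\<^sub>0, \<dots>, X\<^sub>n\<^sub>-\<^sub>1\<close> are the ones in which no other
  indeterminate occurs.
\<close>

type_synonym polynomial = "(nat \<Rightarrow>\<^sub>0 nat) \<Rightarrow>\<^sub>0 int"

definition indet :: "nat \<Rightarrow> polynomial" where
  "indet i = Poly_Mapping.single (Poly_Mapping.single i 1) 1"

definition alternant :: "nat \<Rightarrow> composition \<Rightarrow> polynomial" where
  "alternant n \<alpha> =
    (\<Sum>\<sigma> | \<sigma> permutes {..<n}. of_int (sign \<sigma>) * (\<Prod>i<n. indet (\<sigma> i) ^ part \<alpha> i))"

text \<open>
  The type \<^typ>\<open>polynomial\<close> is an integral domain, so the exact quotient below is unique; it is a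
  polynomial in \<open>X\<^sub>0, \<dots>, X\<^sub>n\<^sub>-\<^sub>1\<close> because numerator and denominator are.
\<close>

definition schur_poly :: "nat \<Rightarrow> composition \<Rightarrow> polynomial" where
  "schur_poly n \<alpha> =
    (if \<alpha> \<in> compositions_in n
     then THE p. p * alternant n (staircase n) = alternant n (staircase n + \<alpha>)
     else 0)"

text \<open>Setting \<open>X\<^sub>i = 0\<close> for all \<open>i \<ge> n\<close>.\<close>

lift_definition truncate_vars :: "nat \<Rightarrow> symfun \<Rightarrow> polynomial" is
  "\<lambda>n f m. if Poly_Mapping.keys m \<subseteq> {..<n} then f m else 0"
proof -
  fix n and f :: series
  assume "symmetric_series f \<and> bounded_degree f"
  then obtain d where d: "\<And>m. f m \<noteq> 0 \<Longrightarrow> total_degree m \<le> d"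
    unfolding bounded_degree_def by blast
  have "{m. (if Poly_Mapping.keys m \<subseteq> {..<n} then f m else 0) \<noteq> 0} \<subseteq>
      {m. Poly_Mapping.keys m \<subseteq> {..<n} \<and> total_degree m \<le> d}"
    using d by (auto split: if_splits)
  then show "finite {m. (if Poly_Mapping.keys m \<subseteq> {..<n} then f m else 0) \<noteq> 0}"
    by (rule finite_subset) (simp add: finite_exponents)
qed

definition schur :: "composition \<Rightarrow> symfun" where
  "schur \<alpha> = (THE f. \<forall>n. truncate_vars n f = schur_poly n \<alpha>)"


section \<open>The scalar product and skew Schur functions\<close>

definition symmetric_bilinear :: "(symfun \<Rightarrow> symfun \<Rightarrow> int) \<Rightarrow> bool" where
  "symmetric_bilinear B \<longleftrightarrow>
    (\<forall>f g. B f g = B g f) \<and> (\<forall>f g h. B (f + g) h = B f h + B g h)"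

definition scalar_product :: "symfun \<Rightarrow> symfun \<Rightarrow> int" where
  "scalar_product = (THE B. symmetric_bilinear B \<and>
    (\<forall>lam\<in>partitions. \<forall>mu\<in>partitions. B (schur lam) (schur mu) = (if lam = mu then 1 else 0)))"

definition skew_schur :: "composition \<Rightarrow> composition \<Rightarrow> symfun" where
  "skew_schur lam mu =
    (THE g. \<forall>f. scalar_product g f = scalar_product (schur lam) (schur mu * f))"

end

(*
  For \<lambda> in N^l, the coefficient of s_\<lambda> in a symmetric function f is the coefficient of X^(\<lambda>+\<delta>) in
  a_\<delta> f, computed in l variables. Hence <s_\<lambda>, s_\<mu> f> is the coefficient of X^(\<lambda>+\<delta>) in a_(\<mu>+\<delta>) f,
  which is the alternating sum over \<sigma> of the coefficients of X^(\<lambda>+\<delta>-\<sigma>(\<mu>+\<delta>)) in f. As the products h_z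
  are dual to the monomials X^z, this is the scalar product of f with the Jacobi-Trudi determinant.
  The duality reduces to the case \<mu> = 0 of the identity, which follows from the generating function
  of the h_m, and to the symmetry [X^w] h_z = [X^z] h_w, the transposition of contingency tables.
*)
theory Submission
  imports Defs "HOL-Computational_Algebra.Formal_Power_Series"
begin

section \<open>Truncation to finitely many variables\<close>

text \<open>\<open>schur\<close>, \<open>scalar_product\<close> and \<open>skew_schur\<close> are
  definite descriptions, so each needs a witness together with a uniqueness proof. For s_\<lambda>
  the witness is the determinant for \<mu> = 0. It has to agree with \<open>schur_poly\<close> after
  truncation to every number of variables: for few variables both must be 0, for many the
  determinant must not depend on its size. For the scalar product the witness is the sum of products
  of Schur coordinates, and its uniqueness needs that the s_\<nu> span over the integers; this comes
  from lexicographically leading exponents in d variables, where d bounds the degree. A coordinate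
  read off in n variables might depend on n; it does not, because both readings are additive and
  agree on the s_\<nu>. For the skew function the witness is the determinant itself, unique by
  nondegeneracy.\<close>

lemma lookup_times_polynomial:
  fixes p q :: polynomial
  shows "Poly_Mapping.lookup (p * q) m =
    (\<Sum>(a, b)\<in>{(a, b). a + b = m}. Poly_Mapping.lookup p a * Poly_Mapping.lookup q b)"
proof -
  have "Poly_Mapping.lookup (p * q) m =
      (\<Sum>(a, b). Poly_Mapping.lookup p a * Poly_Mapping.lookup q b when m = a + b)"
    unfolding times_poly_mapping.rep_eq by (rule prod_fun_unfold_prod) auto
  also have "\<dots> = (\<Sum>(a, b)\<in>{(a, b). a + b = m}.
      Poly_Mapping.lookup p a * Poly_Mapping.lookup q b when m = a + b)"
    by (rule Sum_any.expand_superset) (auto simp: finite_decompositions)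
  also have "\<dots> = (\<Sum>(a, b)\<in>{(a, b). a + b = m}. Poly_Mapping.lookup p a * Poly_Mapping.lookup q b)"
    by (rule sum.cong) auto
  finally show ?thesis .
qed

lemma lookup_times_single:
  fixes p :: polynomial
  shows "Poly_Mapping.lookup (p * Poly_Mapping.single b c) a =
    (if \<forall>i. part b i \<le> part a i then Poly_Mapping.lookup p (a - b) * c else 0)"
proof -
  have "Poly_Mapping.lookup (p * Poly_Mapping.single b c) a =
      (\<Sum>(x, y)\<in>{(x, y). x + y = a}. Poly_Mapping.lookup p x * (c when b = y))"
    by (simp add: lookup_times_polynomial lookup_single)
  also have "\<dots> = (\<Sum>(x, y)\<in>{(x, y). x + y = a \<and> y = b}. Poly_Mapping.lookup p x * (c when b = y))"
    by (rule sum.mono_neutral_right) (auto simp: finite_decompositions)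
  also have "{(x, y). x + y = a \<and> y = b} = (if \<forall>i. part b i \<le> part a i then {(a - b, b)} else {})"
  proof -
    have "a - b + b = a" if "\<forall>i. part b i \<le> part a i"
      using that by (auto intro!: poly_mapping_eqI simp: lookup_add lookup_minus)
    then show ?thesis by (auto simp: lookup_add)
  qed
  finally show ?thesis by (auto split: if_splits)
qed

lemma keys_add_nat: "Poly_Mapping.keys (a + b) = Poly_Mapping.keys a \<union> Poly_Mapping.keys (b :: composition)"
  by (auto simp: in_keys_iff lookup_add)

lemma compositions_in_iff_keys: "\<alpha> \<in> compositions_in n \<longleftrightarrow> Poly_Mapping.keys \<alpha> \<subseteq> {..<n}"
proof -
  have "(n \<le> i \<longrightarrow> part \<alpha> i = 0) \<longleftrightarrow> (i \<in> Poly_Mapping.keys \<alpha> \<longrightarrow> i \<in> {..<n})" for i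
    by (cases "i < n") (auto simp: in_keys_iff)
  then show ?thesis by (simp only: compositions_in_def subset_iff mem_Collect_eq)
qed

lemma lookup_truncate_vars:
  "Poly_Mapping.lookup (truncate_vars n f) m =
    (if Poly_Mapping.keys m \<subseteq> {..<n} then symfun_coeff f m else 0)"
  by (simp add: truncate_vars.rep_eq)

lemma truncate_vars_add: "truncate_vars n (f + g) = truncate_vars n f + truncate_vars n g"
  by (rule poly_mapping_eqI) (simp add: lookup_truncate_vars lookup_add plus_symfun.rep_eq)

text \<open>Exponents are natural numbers and cannot cancel, so a + b is supported below n exactly
  when a and b both are.\<close>

lemma truncate_vars_times: "truncate_vars n (f * g) = truncate_vars n f * truncate_vars n g"
proof (rule poly_mapping_eqI)
  fix m
  show "Poly_Mapping.lookup (truncate_vars n (f * g)) m =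
      Poly_Mapping.lookup (truncate_vars n f * truncate_vars n g) m"
    unfolding lookup_times_polynomial lookup_truncate_vars times_symfun.rep_eq series_times_def
    by (auto simp: keys_add_nat intro!: sum.cong sum.neutral)
qed

lemma truncate_vars_one: "truncate_vars n 1 = 1"
  by (rule poly_mapping_eqI) (simp add: lookup_truncate_vars one_symfun.rep_eq lookup_one when_def)

lemma truncate_vars_zero: "truncate_vars n 0 = 0"
  by (rule poly_mapping_eqI) (simp add: lookup_truncate_vars zero_symfun.rep_eq)

interpretation truncate_vars: comm_ring_hom "truncate_vars n" for n
  by unfold_locales
    (simp_all add: truncate_vars_add truncate_vars_times truncate_vars_one truncate_vars_zero)

lemma symfun_eqI:
  assumes "\<And>n. truncate_vars n f = truncate_vars n g"
  shows "f = g"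
proof -
  have "symfun_coeff f m = symfun_coeff g m" for m
  proof -
    obtain n where "Poly_Mapping.keys m \<subseteq> {..<n}"
      using finite_nat_iff_bounded[of "Poly_Mapping.keys m"] by auto
    then show ?thesis
      using arg_cong[OF assms[of n], of "\<lambda>p. Poly_Mapping.lookup p m"]
      by (simp add: lookup_truncate_vars)
  qed
  then show ?thesis by (simp add: symfun_coeff_inject[symmetric] fun_eq_iff)
qed

lemma symfun_coeff_complete_h:
  "symfun_coeff (complete_h z) m = (if z = int (total_degree m) then 1 else 0)"
  by (auto simp: complete_h.rep_eq complete_series_eq)

lemma total_degree_single [simp]: "total_degree (Poly_Mapping.single i k) = k"
  by (simp add: total_degree_def)

lemma total_degree_eq_0_iff [simp]: "total_degree m = 0 \<longleftrightarrow> m = 0"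
  by (metis bot_nat_0.extremum_uniqueI lookup_le_total_degree lookup_zero poly_mapping_eqI total_degree_0)

lemma complete_h_neg [simp]: "z < 0 \<Longrightarrow> complete_h z = 0"
  by (simp add: symfun_coeff_inject[symmetric] complete_h.rep_eq zero_symfun.rep_eq)

lemma complete_h_0 [simp]: "complete_h 0 = 1"
  by (auto simp: symfun_coeff_inject[symmetric] symfun_coeff_complete_h one_symfun.rep_eq)

lemma lookup_times_indet:
  fixes p :: polynomial
  shows "Poly_Mapping.lookup (p * indet i) a =
    (if part a i = 0 then 0 else Poly_Mapping.lookup p (a - Poly_Mapping.single i 1))"
  by (auto simp: indet_def lookup_times_single lookup_single when_def)

section \<open>The generating function of the complete functions\<close>

definition complete_gf :: "nat \<Rightarrow> polynomial fps" where
  "complete_gf n = Abs_fps (\<lambda>m. truncate_vars n (complete_h (int m)))"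

abbreviation linear_fps :: "polynomial \<Rightarrow> polynomial fps" where
  "linear_fps c \<equiv> 1 - fps_const c * fps_X"

lemma complete_gf_0: "complete_gf 0 = 1"
  by (auto simp: complete_gf_def fps_eq_iff lookup_truncate_vars symfun_coeff_complete_h
      lookup_one when_def intro!: poly_mapping_eqI)

lemma nth_times_linear_fps:
  "fps_nth (F * linear_fps c) m = fps_nth F m - (if m = 0 then 0 else fps_nth F (m - 1) * c)"
proof -
  have "F * linear_fps c = F - F * fps_const c * fps_X"
    by (simp only: right_diff_distrib mult_1_right mult.assoc)
  then show ?thesis by simp
qed

text \<open>A monomial of degree m divisible by X_n is X_n times exactly one monomial of degree m -
  1. These cancel, and the monomials free of X_n remain.\<close>

lemma complete_gf_Suc: "complete_gf (Suc n) * linear_fps (indet n) = complete_gf n"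
proof (rule fps_ext, rule poly_mapping_eqI)
  fix m a
  have keys: "Poly_Mapping.keys a \<subseteq> {..<Suc n} \<longleftrightarrow> Poly_Mapping.keys a \<subseteq> {..<n}" if "part a n = 0"
    using that by (metis in_keys_iff lessThan_Suc subset_insert)
  have split: "Poly_Mapping.keys a = insert n (Poly_Mapping.keys (a - Poly_Mapping.single n 1))"
      "total_degree a = Suc (total_degree (a - Poly_Mapping.single n 1))" if "part a n \<noteq> 0"
  proof -
    have "a = (a - Poly_Mapping.single n 1) + Poly_Mapping.single n 1"
      using that by (auto intro!: poly_mapping_eqI simp: lookup_add lookup_minus lookup_single when_def)
    then show "Poly_Mapping.keys a = insert n (Poly_Mapping.keys (a - Poly_Mapping.single n 1))"
      "total_degree a = Suc (total_degree (a - Poly_Mapping.single n 1))"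
      using keys_add_nat[of "a - Poly_Mapping.single n 1" "Poly_Mapping.single n 1"]
        total_degree_add[of "a - Poly_Mapping.single n 1" "Poly_Mapping.single n 1"]
      by (simp_all flip: \<open>a = _\<close>)
  qed
  show "Poly_Mapping.lookup (fps_nth (complete_gf (Suc n) * linear_fps (indet n)) m) a =
      Poly_Mapping.lookup (fps_nth (complete_gf n) m) a"
    using keys split
    by (cases "part a n = 0")
      (auto simp: nth_times_linear_fps complete_gf_def lookup_minus lookup_times_indet
        lookup_truncate_vars symfun_coeff_complete_h)
qed

lemma complete_gf_times_prod: "complete_gf n * (\<Prod>i<n. linear_fps (indet i)) = 1"
proof (induction n)
  case 0
  then show ?case by (simp add: complete_gf_0)
next
  case (Suc n)
  have "complete_gf (Suc n) * (\<Prod>i<Suc n. linear_fps (indet i)) =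
      (complete_gf (Suc n) * linear_fps (indet n)) * (\<Prod>i<n. linear_fps (indet i))"
    by (simp only: prod.lessThan_Suc mult_ac)
  then show ?case by (simp only: complete_gf_Suc Suc)
qed

text \<open>Both sides are inverses of \<open>linear_fps (indet j)\<close>, and inverses in a
  commutative ring are unique.\<close>

lemma complete_gf_times_prod_delete:
  assumes "j < n"
  shows "complete_gf n * (\<Prod>i\<in>{..<n} - {j}. linear_fps (indet i)) = Abs_fps (\<lambda>m. indet j ^ m)"
    (is "?L = ?G")
proof -
  have G: "?G * linear_fps (indet j) = 1"
    by (rule fps_ext) (auto simp: nth_times_linear_fps simp flip: power_Suc2)
  have L: "?L * linear_fps (indet j) = 1"
    using complete_gf_times_prod[of n] assms by (simp add: prod.remove[of _ j] mult_ac)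
  have "?L = ?L * (?G * linear_fps (indet j))" by (simp only: G mult_1_right)
  also have "\<dots> = (?L * linear_fps (indet j)) * ?G" by (simp only: mult_ac)
  finally show ?thesis by (simp only: L mult_1_left)
qed

lemma nth_prod_linear_fps:
  assumes "finite A" "card A < k"
  shows "fps_nth (\<Prod>i\<in>A. linear_fps (c i)) k = 0"
  using assms
proof (induction A arbitrary: k rule: finite_induct)
  case (insert x A)
  have "fps_nth (\<Prod>i\<in>insert x A. linear_fps (c i)) k =
      fps_nth ((\<Prod>i\<in>A. linear_fps (c i)) * linear_fps (c x)) k"
    unfolding prod.insert[OF insert(1,2)] by (simp only: mult.commute)
  then show ?case using insert by (auto simp: nth_times_linear_fps)
qed auto

text \<open>A row of complete functions times a column of reversed coefficients of \<open>Q\<close>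
  is a Cauchy product. The range of summation can be changed from k < l to k \<le> m because
  \<open>Q\<close> vanishes from l on and h vanishes at negative indices.\<close>

lemma nth_complete_gf_times:
  assumes "\<And>k. k \<ge> l \<Longrightarrow> fps_nth Q k = 0"
  shows "(\<Sum>j<l. truncate_vars n (complete_h (int m - int (l - 1 - j))) * fps_nth Q (l - 1 - j)) =
    fps_nth (complete_gf n * Q) m"
proof -
  let ?f = "\<lambda>k. truncate_vars n (complete_h (int m - int k)) * fps_nth Q k"
  have "(\<Sum>j<l. ?f (l - 1 - j)) = (\<Sum>k<l. ?f k)"
    by (rule sum.reindex_bij_witness[of _ "\<lambda>j. l - 1 - j" "\<lambda>j. l - 1 - j"]) auto
  also have "\<dots> = (\<Sum>k<l + Suc m. ?f k)"
    by (rule sum.mono_neutral_left) (auto simp: assms)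
  also have "\<dots> = (\<Sum>k=0..m. ?f k)"
    by (rule sum.mono_neutral_right) auto
  also have "\<dots> = fps_nth (complete_gf n * Q) m"
    by (subst mult.commute) (simp add: fps_mult_nth complete_gf_def of_nat_diff mult.commute)
  finally show ?thesis .
qed

section \<open>Schur functions as determinants\<close>

definition jacobi_trudi :: "nat \<Rightarrow> composition \<Rightarrow> composition \<Rightarrow> symfun" where
  "jacobi_trudi n a b = det (mat n n (\<lambda>(i, j). complete_h (bracket a i - bracket b j)))"

lemma truncate_jacobi_trudi:
  "truncate_vars n (jacobi_trudi l a b) =
    det (mat l l (\<lambda>(i, j). truncate_vars n (complete_h (bracket a i - bracket b j))))"
  unfolding jacobi_trudi_def truncate_vars.hom_det[symmetric]
  by (rule arg_cong[of _ _ det]) (auto intro!: eq_matI)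

lemma alternant_eq_det: "alternant n \<alpha> = det (mat n n (\<lambda>(i, j). indet j ^ part \<alpha> i))"
proof -
  have "det (mat n n (\<lambda>(i, j). indet j ^ part \<alpha> i)) =
      (\<Sum>p | p permutes {0..<n}. of_int (sign p) * (\<Prod>i = 0..<n. indet (p i) ^ part \<alpha> i))"
    by (subst det_def'[of _ n])
      (auto intro!: sum.cong prod.cong arg_cong2[of _ _ _ _ "(*)"] simp: permutes_in_image)
  then show ?thesis by (simp add: alternant_def atLeast0LessThan)
qed

lemma lookup_staircase: "part (staircase n) i = (if i < n then n - 1 - i else 0)"
  by (simp add: staircase.rep_eq)

text \<open>
  With \<open>H\<close> the generating function of the \<open>h\<^sub>m\<close>, the factorisation
  \<open>1 / (1 - X\<^sub>j t) = H(t) \<cdot> \<Prod>i\<noteq>j. (1 - X\<^sub>i t)\<close> expresses the powers of \<open>X\<^sub>j\<close> as combinations of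
  complete functions whose coefficients do not depend on the exponent.
\<close>

lemma alternant_staircase_add:
  "alternant n (staircase n + \<alpha>) =
    truncate_vars n (jacobi_trudi n \<alpha> 0) * alternant n (staircase n)"
proof -
  define Q :: "nat \<Rightarrow> polynomial fps" where
    "Q j = (\<Prod>i\<in>{..<n} - {j}. linear_fps (indet i))" for j
  define P where "P = mat n n (\<lambda>(k, j). fps_nth (Q j) (n - 1 - k))"
  define A where
    "A \<beta> = mat n n (\<lambda>(i, j). truncate_vars n (complete_h (bracket \<beta> i - bracket 0 j)))" for \<beta>
  have factor: "alternant n (staircase n + \<beta>) = det (A \<beta>) * det P" for \<beta>
  proof -
    have "mat n n (\<lambda>(i, j). indet j ^ part (staircase n + \<beta>) i) = A \<beta> * P"
    proof (rule eq_matI)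
      fix i j assume "i < dim_row (A \<beta> * P)" "j < dim_col (A \<beta> * P)"
      then have i: "i < n" and j: "j < n" by (auto simp: A_def P_def)
      define m where "m = part (staircase n + \<beta>) i"
      have deg: "fps_nth (Q j) k = 0" if "k \<ge> n" for k
        unfolding Q_def by (rule nth_prod_linear_fps) (use that j in auto)
      have "(A \<beta> * P) $$ (i, j) =
          (\<Sum>k<n. truncate_vars n (complete_h (bracket \<beta> i - bracket 0 k)) * fps_nth (Q j) (n - 1 - k))"
        using i j by (simp add: A_def P_def scalar_prod_def atLeast0LessThan)
      also have "\<dots> = (\<Sum>k<n. truncate_vars n (complete_h (int m - int (n - 1 - k))) *
          fps_nth (Q j) (n - 1 - k))"
        using i
        by (intro sum.cong refl arg_cong2[of _ _ _ _ "(*)"] arg_cong[of _ _ "truncate_vars n"]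
            arg_cong[of _ _ complete_h])
          (auto simp: bracket_def m_def lookup_add lookup_staircase)
      also have "\<dots> = fps_nth (complete_gf n * Q j) m"
        by (rule nth_complete_gf_times) (rule deg)
      also have "\<dots> = indet j ^ m"
        unfolding Q_def complete_gf_times_prod_delete[OF j] by simp
      finally show "mat n n (\<lambda>(i, j). indet j ^ part (staircase n + \<beta>) i) $$ (i, j) = (A \<beta> * P) $$ (i, j)"
        using i j by (simp add: m_def)
    qed (auto simp: A_def P_def)
    then show ?thesis
      unfolding alternant_eq_det by (simp only:) (rule det_mult[of _ n]; simp add: A_def P_def)
  qed
  have "det (A 0) = prod_list (diag_mat (A 0))"
    by (rule det_upper_triangular[of _ n])
      (auto simp: A_def bracket_def upper_triangular_def truncate_vars.hom_zero)
  also have "\<dots> = 1"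
    by (simp add: A_def bracket_def prod_list_diag_prod truncate_vars.hom_one)
  finally have "alternant n (staircase n) = det P"
    using factor[of 0] by simp
  with factor[of \<alpha>] show ?thesis by (simp add: truncate_jacobi_trudi A_def)
qed

text \<open>In n < l variables the product of the 1 - X_i t has degree below l, so its coefficients
  fit into a vector of length l, nonzero because of the constant term 1. Each row sends this vector
  to a coefficient of positive index in H(t) times the product, that is, in 1. A nonzero kernel
  vector makes the determinant 0.\<close>

lemma truncate_jacobi_trudi_eq_0:
  assumes "\<alpha> \<in> partitions" "part \<alpha> (l - 1) > 0" "n < l"
  shows "truncate_vars n (jacobi_trudi l \<alpha> 0) = 0"
proof -
  define Q where "Q = (\<Prod>i<n. linear_fps (indet i))"
  define A where
    "A = mat l l (\<lambda>(i, j). truncate_vars n (complete_h (bracket \<alpha> i - bracket 0 j)))"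
  define v where "v = vec l (\<lambda>j. fps_nth Q (l - 1 - j))"
  have deg: "fps_nth Q k = 0" if "k \<ge> l" for k
    unfolding Q_def by (rule nth_prod_linear_fps) (use that assms in auto)
  have "fps_nth (\<Prod>i<k. linear_fps (indet i)) 0 = 1" for k
    by (induction k) simp_all
  then have "fps_nth Q 0 = 1" by (simp add: Q_def)
  then have "v $ (l - 1) \<noteq> 0"
    using assms by (simp add: v_def)
  then have "v \<noteq> 0\<^sub>v l"
    using assms by auto
  moreover have "A *\<^sub>v v = 0\<^sub>v l"
  proof (rule eq_vecI)
    fix i assume "i < dim_vec (0\<^sub>v l :: polynomial vec)"
    then have i: "i < l" by simp
    define m where "m = part \<alpha> i + (l - 1 - i)"
    \<comment> \<open>In row l - 1 the summand l - 1 - i of \<open>m\<close> is 0, so positivity has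
      to come from the last part of \<alpha>.\<close>
    have "part \<alpha> (l - 1) \<le> part \<alpha> i"
      using assms i by (auto simp: partitions_def)
    then have m: "m > 0" using assms by (auto simp: m_def)
    have "(A *\<^sub>v v) $ i =
        (\<Sum>k<l. truncate_vars n (complete_h (bracket \<alpha> i - bracket 0 k)) * fps_nth Q (l - 1 - k))"
      using i by (simp add: A_def v_def scalar_prod_def atLeast0LessThan)
    also have "\<dots> = (\<Sum>k<l. truncate_vars n (complete_h (int m - int (l - 1 - k))) *
          fps_nth Q (l - 1 - k))"
      using i
      by (intro sum.cong refl arg_cong2[of _ _ _ _ "(*)"] arg_cong[of _ _ "truncate_vars n"]
          arg_cong[of _ _ complete_h]) (auto simp: bracket_def m_def)
    also have "\<dots> = fps_nth (complete_gf n * Q) m"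
      by (rule nth_complete_gf_times) (rule deg)
    also have "\<dots> = 0"
      unfolding Q_def complete_gf_times_prod using m by simp
    finally show "(A *\<^sub>v v) $ i = 0\<^sub>v l $ i" using i by simp
  qed (simp add: A_def)
  moreover have "A \<in> carrier_mat l l" "v \<in> carrier_vec l"
    by (simp_all add: A_def v_def)
  ultimately have "det A = 0"
    using det_0_iff_vec_prod_zero[of A l] by blast
  then show ?thesis by (simp add: truncate_jacobi_trudi A_def)
qed

text \<open>Since part l of \<alpha> is 0, the last row has the entries h_(j-l): zeros followed by a
  final 1. Expanding along it removes the last row and column.\<close>

lemma jacobi_trudi_Suc:
  assumes "\<alpha> \<in> compositions_in l"
  shows "jacobi_trudi (Suc l) \<alpha> 0 = jacobi_trudi l \<alpha> 0"
proof -
  let ?A = "mat (Suc l) (Suc l) (\<lambda>(i, j). complete_h (bracket \<alpha> i - bracket 0 j))"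
  have "det ?A = (\<Sum>j<Suc l. ?A $$ (l, j) * cofactor ?A l j)"
    by (rule laplace_expansion_row) auto
  also have "\<dots> = (\<Sum>j\<in>{l}. ?A $$ (l, j) * cofactor ?A l j)"
    using assms by (intro sum.mono_neutral_right) (auto simp: bracket_def compositions_in_def)
  also have "\<dots> = cofactor ?A l l"
    using assms by (simp add: bracket_def compositions_in_def)
  also have "\<dots> = det (mat_delete ?A l l)"
    by (simp add: cofactor_def flip: mult_2)
  also have "mat_delete ?A l l = mat l l (\<lambda>(i, j). complete_h (bracket \<alpha> i - bracket 0 j))"
    by (auto simp: mat_delete_def intro!: eq_matI)
  finally show ?thesis by (simp add: jacobi_trudi_def)
qed

lemma jacobi_trudi_size_indep:
  assumes "\<alpha> \<in> compositions_in l" "l \<le> n"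
  shows "jacobi_trudi n \<alpha> 0 = jacobi_trudi l \<alpha> 0"
  using assms(2,1)
  by (induction n rule: dec_induct) (auto simp: compositions_in_def intro!: trans[OF jacobi_trudi_Suc])

section \<open>Coefficients of a symmetric polynomial times an alternant\<close>

lift_definition exponent_vec :: "nat \<Rightarrow> (nat \<Rightarrow> int) \<Rightarrow> composition" is
  "\<lambda>n z i. if i < n then nat (z i) else 0"
  by simp

text \<open>The coefficient of X^z for an integer vector z. The guard matters because
  \<open>exponent_vec\<close> clips negative entries to 0; the value 0 corresponds to h_d = 0 for d
  < 0.\<close>

definition zcoeff :: "nat \<Rightarrow> (nat \<Rightarrow> int) \<Rightarrow> symfun \<Rightarrow> int" where
  "zcoeff n z f = (if \<forall>i<n. 0 \<le> z i then symfun_coeff f (exponent_vec n z) else 0)"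

lemma lookup_exponent_vec: "part (exponent_vec n z) i = (if i < n then nat (z i) else 0)"
  by (simp add: exponent_vec.rep_eq)

lemma prod_indet_power:
  assumes "finite A"
  shows "(\<Prod>i\<in>A. indet i ^ e i) = Poly_Mapping.single (\<Sum>i\<in>A. Poly_Mapping.single i (e i)) 1"
proof -
  have "indet i ^ k = Poly_Mapping.single (Poly_Mapping.single i k) 1" for i k
    by (induction k) (auto simp: indet_def mult_single simp flip: single_add)
  with assms show ?thesis
    by (induction A rule: finite_induct) (auto simp: mult_single)
qed

text \<open>Passing to the inverse permutation, which has the same sign, moves \<sigma> from the
  indeterminates to the exponents.\<close>

lemma alternant_eq_sum_single:
  "alternant n \<beta> = (\<Sum>\<sigma> | \<sigma> permutes {..<n}.
    Poly_Mapping.single (\<Sum>i<n. Poly_Mapping.single i (part \<beta> (\<sigma> i))) (sign \<sigma>))"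
proof -
  have "alternant n \<beta> = (\<Sum>\<sigma> | \<sigma> permutes {..<n}. of_int (sign (inv_into UNIV \<sigma>)) *
      (\<Prod>i<n. indet (inv_into UNIV \<sigma> i) ^ part \<beta> i))"
    unfolding alternant_def by (rule sum_permutations_inverse)
  also have "\<dots> = (\<Sum>\<sigma> | \<sigma> permutes {..<n}.
    Poly_Mapping.single (\<Sum>i<n. Poly_Mapping.single i (part \<beta> (\<sigma> i))) (sign \<sigma>))"
  proof (rule sum.cong[OF refl])
    fix \<sigma> assume "\<sigma> \<in> {\<sigma>. \<sigma> permutes {..<n}}"
    then have \<sigma>: "\<sigma> permutes {..<n}" by simp
    have "(\<Prod>i<n. indet (inv_into UNIV \<sigma> i) ^ part \<beta> i) = (\<Prod>i<n. indet i ^ part \<beta> (\<sigma> i))"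
      using prod.permute[OF \<sigma>, of "\<lambda>i. indet (inv_into UNIV \<sigma> i) ^ part \<beta> i"]
      by (simp add: permutes_inverses[OF \<sigma>] o_def)
    also have "\<dots> = Poly_Mapping.single (\<Sum>i<n. Poly_Mapping.single i (part \<beta> (\<sigma> i))) 1"
      by (rule prod_indet_power) simp
    finally show "of_int (sign (inv_into UNIV \<sigma>)) * (\<Prod>i<n. indet (inv_into UNIV \<sigma> i) ^ part \<beta> i) =
        Poly_Mapping.single (\<Sum>i<n. Poly_Mapping.single i (part \<beta> (\<sigma> i))) (sign \<sigma>)"
      using \<sigma> by (simp add: sign_inverse permutes_imp_permutation[of "{..<n}"]
          mult_single flip: single_of_int)
  qed
  finally show ?thesis .
qed

lemma lookup_truncate_times_alternant:
  assumes "\<alpha> \<in> compositions_in n"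
  shows "Poly_Mapping.lookup (truncate_vars n f * alternant n \<beta>) \<alpha> =
    (\<Sum>\<sigma> | \<sigma> permutes {..<n}. sign \<sigma> * zcoeff n (\<lambda>i. int (part \<alpha> i) - int (part \<beta> (\<sigma> i))) f)"
proof -
  have "Poly_Mapping.lookup (truncate_vars n f * alternant n \<beta>) \<alpha> =
    (\<Sum>\<sigma> | \<sigma> permutes {..<n}. Poly_Mapping.lookup (truncate_vars n f *
      Poly_Mapping.single (\<Sum>i<n. Poly_Mapping.single i (part \<beta> (\<sigma> i))) (sign \<sigma>)) \<alpha>)"
    by (simp add: alternant_eq_sum_single sum_distrib_left lookup_sum)
  also have "\<dots> = (\<Sum>\<sigma> | \<sigma> permutes {..<n}.
      sign \<sigma> * zcoeff n (\<lambda>i. int (part \<alpha> i) - int (part \<beta> (\<sigma> i))) f)"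
  proof (rule sum.cong[OF refl])
    fix \<sigma> assume "\<sigma> \<in> {\<sigma>. \<sigma> permutes {..<n}}"
    define b where "b = (\<Sum>i<n. Poly_Mapping.single i (part \<beta> (\<sigma> i)))"
    define z where "z = (\<lambda>i. int (part \<alpha> i) - int (part \<beta> (\<sigma> i)))"
    have b: "part b i = (if i < n then part \<beta> (\<sigma> i) else 0)" for i
      by (simp add: b_def lookup_sum lookup_single when_def)
    have "\<alpha> - b = exponent_vec n z"
      using assms
      by (auto intro!: poly_mapping_eqI
          simp: lookup_minus b lookup_exponent_vec z_def compositions_in_def nat_diff_distrib')
    moreover have "(\<forall>i. part b i \<le> part \<alpha> i) \<longleftrightarrow> (\<forall>i<n. 0 \<le> z i)"
      by (auto simp: b z_def)
    moreover have "Poly_Mapping.keys (exponent_vec n z) \<subseteq> {..<n}"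
      by (auto simp: in_keys_iff lookup_exponent_vec split: if_splits)
    ultimately show "Poly_Mapping.lookup (truncate_vars n f * Poly_Mapping.single b (sign \<sigma>)) \<alpha> =
        sign \<sigma> * zcoeff n z f"
      by (cases "\<forall>i<n. 0 \<le> z i")
        (simp_all add: lookup_times_single zcoeff_def lookup_truncate_vars del: not_all)
  qed
  finally show ?thesis .
qed

text \<open>As A and B both decrease strictly, \<sigma> is strictly increasing on the indices below
  n. Hence i \<le> \<sigma> i throughout, which forces the identity.\<close>

lemma strict_antimono_permutes_eq_id:
  fixes A B :: "nat \<Rightarrow> nat"
  assumes A: "\<And>i j. i < j \<Longrightarrow> j < n \<Longrightarrow> A j < A i"
    and B: "\<And>i j. i < j \<Longrightarrow> j < n \<Longrightarrow> B j < B i"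
    and \<sigma>: "\<sigma> permutes {..<n}" and eq: "\<And>i. i < n \<Longrightarrow> A i = B (\<sigma> i)"
  shows "\<sigma> = id"
proof (rule permutes_natset_ge[OF \<sigma>])
  have lt: "\<sigma> i < n" if "i < n" for i
    using permutes_in_image[OF \<sigma>, of i] that by simp
  have mono: "\<sigma> i < \<sigma> j" if "i < j" "j < n" for i j
  proof -
    have "B (\<sigma> j) < B (\<sigma> i)" using A[OF that] eq[of i] eq[of j] that by simp
    then show ?thesis
      using B[of "\<sigma> j" "\<sigma> i"] lt[of i] that by (cases "\<sigma> i" "\<sigma> j" rule: linorder_cases) auto
  qed
  have "i < n \<Longrightarrow> i \<le> \<sigma> i" for i
  proof (induction i)
    case (Suc i)
    then show ?case using mono[of i "Suc i"] by simp
  qed simp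
  then show "\<forall>i\<in>{..<n}. i \<le> \<sigma> i" by simp
qed

lemma staircase_add_strict_antimono:
  assumes "\<alpha> \<in> partitions" "i < j" "j < n"
  shows "part (staircase n + \<alpha>) j < part (staircase n + \<alpha>) i"
proof -
  have "part \<alpha> j \<le> part \<alpha> i" using assms by (simp add: partitions_def)
  then show ?thesis using assms by (simp add: lookup_add lookup_staircase)
qed

lemma staircase_add_in_compositions_in:
  "staircase n + \<alpha> \<in> compositions_in n \<longleftrightarrow> \<alpha> \<in> compositions_in n"
  by (auto simp: compositions_in_def lookup_add lookup_staircase)

text \<open>The source of orthonormality. Adding the staircase makes partitions strictly decreasing,
  so no permutation other than the identity can carry one shifted exponent to the other.\<close>

lemma lookup_alternant_staircase_add:
  assumes "\<alpha> \<in> partitions" "\<beta> \<in> partitions" "\<alpha> \<in> compositions_in n" "\<beta> \<in> compositions_in n"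
  shows "Poly_Mapping.lookup (alternant n (staircase n + \<beta>)) (staircase n + \<alpha>) =
    (if \<alpha> = \<beta> then 1 else 0)"
proof -
  let ?z = "\<lambda>\<sigma> i. int (part (staircase n + \<alpha>) i) - int (part (staircase n + \<beta>) (\<sigma> i))"
  have one: "zcoeff n z 1 = (if \<forall>i<n. z i = 0 then 1 else 0)" for z
  proof -
    have "exponent_vec n z = 0 \<longleftrightarrow> (\<forall>i<n. z i \<le> 0)"
      by (simp add: poly_mapping_eq_iff fun_eq_iff lookup_exponent_vec)
    then have "(\<forall>i<n. 0 \<le> z i) \<and> exponent_vec n z = 0 \<longleftrightarrow> (\<forall>i<n. z i = 0)"
      by (metis order.antisym order.refl)
    then show ?thesis
      by (cases "\<forall>i<n. 0 \<le> z i") (simp_all add: zcoeff_def one_symfun.rep_eq del: not_all)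
  qed
  have id: "\<sigma> = id" if "\<sigma> permutes {..<n}" "\<forall>i<n. ?z \<sigma> i = 0" for \<sigma>
  proof (rule strict_antimono_permutes_eq_id[OF staircase_add_strict_antimono[OF assms(1)]
          staircase_add_strict_antimono[OF assms(2)] that(1)])
    fix i assume "i < n"
    then show "part (staircase n + \<alpha>) i = part (staircase n + \<beta>) (\<sigma> i)"
      using that by (simp only: right_minus_eq of_nat_eq_iff)
  qed
  have "Poly_Mapping.lookup (alternant n (staircase n + \<beta>)) (staircase n + \<alpha>) =
      Poly_Mapping.lookup (truncate_vars n 1 * alternant n (staircase n + \<beta>)) (staircase n + \<alpha>)"
    by (simp add: truncate_vars.hom_one)
  also have "\<dots> = (\<Sum>\<sigma> | \<sigma> permutes {..<n}. sign \<sigma> * zcoeff n (?z \<sigma>) 1)"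
    using assms by (intro lookup_truncate_times_alternant) (simp add: staircase_add_in_compositions_in)
  also have "\<dots> = (\<Sum>\<sigma>\<in>{id}. sign \<sigma> * zcoeff n (?z \<sigma>) 1)"
    using id by (intro sum.mono_neutral_right) (auto simp: one permutes_id finite_permutations)
  also have "\<dots> = (if \<forall>i<n. ?z id i = 0 then 1 else 0)"
    by (simp add: one)
  also have "(\<forall>i<n. ?z id i = 0) \<longleftrightarrow> \<alpha> = \<beta>"
  proof
    assume *: "\<forall>i<n. ?z id i = 0"
    show "\<alpha> = \<beta>"
    proof (rule poly_mapping_eqI)
      fix i
      show "part \<alpha> i = part \<beta> i"
        using * assms by (cases "i < n") (auto simp: lookup_add compositions_in_def)
    qed
  qed simp
  finally show ?thesis .
qed

lemma alternant_staircase_neq_0: "alternant n (staircase n) \<noteq> 0"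
  using lookup_alternant_staircase_add[of 0 0 n]
  by (auto simp: partitions_def compositions_in_def)

text \<open>Resolves the definite description in \<open>schur\<close>: one determinant has the
  prescribed truncation for every k, and truncations determine a symmetric function.\<close>

lemma
  assumes "\<alpha> \<in> partitions" "\<alpha> \<in> compositions_in n"
  shows schur_eq_jacobi_trudi: "schur \<alpha> = jacobi_trudi n \<alpha> 0"
    and truncate_schur: "truncate_vars k (schur \<alpha>) = schur_poly k \<alpha>"
proof -
  \<comment> \<open>The least possible size. If k < l, part l - 1 is therefore positive, and the
    determinant truncates to 0 in k variables, as \<open>schur_poly\<close> demands.\<close>
  define l where "l = (LEAST l. \<alpha> \<in> compositions_in l)"
  have l: "\<alpha> \<in> compositions_in l"
    unfolding l_def using assms(2) by (rule LeastI)
  have least: "l \<le> k" if "\<alpha> \<in> compositions_in k" for k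
    unfolding l_def using that by (rule Least_le)
  have truncate: "truncate_vars k (jacobi_trudi l \<alpha> 0) = schur_poly k \<alpha>" for k
  proof (cases "l \<le> k")
    case True
    then have k: "\<alpha> \<in> compositions_in k" using l by (auto simp: compositions_in_def)
    have "schur_poly k \<alpha> = (THE p. p * alternant k (staircase k) = alternant k (staircase k + \<alpha>))"
      using k by (simp add: schur_poly_def)
    also have "\<dots> = truncate_vars k (jacobi_trudi k \<alpha> 0)"
      by (rule the_equality) (auto simp: alternant_staircase_add alternant_staircase_neq_0)
    finally show ?thesis using jacobi_trudi_size_indep[OF l True] by simp
  next
    case False
    then have "\<alpha> \<notin> compositions_in k" "\<alpha> \<notin> compositions_in (l - 1)"
      using least[of k] least[of "l - 1"] by auto
    then obtain i where "i \<ge> l - 1" "part \<alpha> i \<noteq> 0"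
      by (auto simp: compositions_in_def)
    moreover from this have "i < l"
      using l unfolding compositions_in_def by (metis (mono_tags) mem_Collect_eq not_le)
    ultimately have "i = l - 1" by linarith
    with \<open>part \<alpha> i \<noteq> 0\<close> have "part \<alpha> (l - 1) > 0" by simp
    then show ?thesis
      using \<open>\<alpha> \<notin> compositions_in k\<close> assms False
      by (simp add: schur_poly_def truncate_jacobi_trudi_eq_0)
  qed
  then have schur: "schur \<alpha> = jacobi_trudi l \<alpha> 0"
    unfolding schur_def by (intro the_equality) (auto intro: symfun_eqI)
  then show "schur \<alpha> = jacobi_trudi n \<alpha> 0"
    using jacobi_trudi_size_indep[OF l least] assms by simp
  show "truncate_vars k (schur \<alpha>) = schur_poly k \<alpha>"
    using truncate schur by simp
qed

lemma truncate_schur_times_alternant: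
  assumes "\<alpha> \<in> partitions" "\<alpha> \<in> compositions_in n"
  shows "truncate_vars n (schur \<alpha>) * alternant n (staircase n) = alternant n (staircase n + \<alpha>)"
  using assms by (simp add: schur_eq_jacobi_trudi alternant_staircase_add)

lemma truncate_schur_eq_0:
  assumes "\<alpha> \<in> partitions" "\<alpha> \<notin> compositions_in n"
  shows "truncate_vars n (schur \<alpha>) = 0"
proof -
  obtain l where "Poly_Mapping.keys \<alpha> \<subseteq> {..<l}"
    using finite_nat_iff_bounded[of "Poly_Mapping.keys \<alpha>"] by auto
  then have "\<alpha> \<in> compositions_in l"
    by (simp add: compositions_in_iff_keys)
  with truncate_schur[OF assms(1) this, of n] assms show ?thesis
    by (simp add: schur_poly_def)
qed

section \<open>Expansion in Schur functions\<close>

text \<open>Integer linearity comes for free from additivity, which is all that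
  \<open>symmetric_bilinear\<close> asks for in each argument.\<close>

lemma additive_of_int_times:
  fixes F :: "'a::comm_ring_1 \<Rightarrow> int"
  assumes "additive F"
  shows "F (of_int c * f) = c * F f"
proof -
  interpret additive F by fact
  have nat: "F (of_nat a * f) = int a * F f" for a
    by (induction a) (simp_all add: zero add distrib_right)
  obtain a b where "c = int a - int b" by (cases c rule: int_diff_cases)
  then show ?thesis by (simp add: diff nat left_diff_distrib)
qed

lemma additive_symfun_coeff: "additive (\<lambda>f. symfun_coeff f m)"
  by unfold_locales (simp add: plus_symfun.rep_eq)

lemma additive_zcoeff: "additive (zcoeff n z)"
  by unfold_locales (cases "\<forall>i<n. 0 \<le> z i"; simp add: zcoeff_def plus_symfun.rep_eq del: not_all)

definition complete_prod :: "nat \<Rightarrow> (nat \<Rightarrow> int) \<Rightarrow> symfun" where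
  "complete_prod n z = (\<Prod>i<n. complete_h (z i))"

lemma jacobi_trudi_expand:
  "jacobi_trudi n \<alpha> \<beta> = (\<Sum>\<sigma> | \<sigma> permutes {..<n}.
    of_int (sign \<sigma>) * complete_prod n (\<lambda>i. bracket \<alpha> i - bracket \<beta> (\<sigma> i)))"
proof -
  have "jacobi_trudi n \<alpha> \<beta> = (\<Sum>\<sigma> | \<sigma> permutes {0..<n}.
      of_int (sign \<sigma>) * (\<Prod>i = 0..<n. complete_h (bracket \<alpha> i - bracket \<beta> (\<sigma> i))))"
    unfolding jacobi_trudi_def
    by (subst det_def'[of _ n])
      (auto intro!: sum.cong prod.cong arg_cong2[of _ _ _ _ "(*)"] simp: permutes_in_image)
  then show ?thesis by (simp add: complete_prod_def atLeast0LessThan)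
qed

section \<open>Homogeneity and degrees\<close>

definition homogeneous :: "int \<Rightarrow> symfun \<Rightarrow> bool" where
  "homogeneous d f \<longleftrightarrow> (\<forall>m. symfun_coeff f m \<noteq> 0 \<longrightarrow> int (total_degree m) = d)"

text \<open>Degrees are integers so that negative d is covered: there h is 0, which is homogeneous
  of every degree.\<close>

lemma homogeneous_complete_h: "homogeneous d (complete_h d)"
  by (auto simp: homogeneous_def symfun_coeff_complete_h split: if_splits)

lemma homogeneous_times:
  assumes "homogeneous d f" "homogeneous e g"
  shows "homogeneous (d + e) (f * g)"
  unfolding homogeneous_def
proof (intro allI impI)
  fix m assume "symfun_coeff (f * g) m \<noteq> 0"
  then obtain p where p: "p \<in> {(a, b). a + b = m}"
      "(case p of (a, b) \<Rightarrow> symfun_coeff f a * symfun_coeff g b) \<noteq> 0"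
    unfolding times_symfun.rep_eq series_times_def by (rule sum.not_neutral_contains_not_neutral)
  then show "int (total_degree m) = d + e"
    using assms by (auto simp: homogeneous_def total_degree_add)
qed

lemma homogeneous_prod:
  assumes "finite A" "\<And>i. i \<in> A \<Longrightarrow> homogeneous (d i) (f i)"
  shows "homogeneous (\<Sum>i\<in>A. d i) (\<Prod>i\<in>A. f i)"
  using assms
proof (induction A rule: finite_induct)
  case empty
  show ?case by (simp add: homogeneous_def one_symfun.rep_eq)
next
  case (insert x A)
  then show ?case by (simp add: homogeneous_times)
qed

lemma homogeneous_sum:
  assumes "\<And>i. i \<in> A \<Longrightarrow> homogeneous d (f i)"
  shows "homogeneous d (\<Sum>i\<in>A. f i)"
  unfolding homogeneous_def additive.sum[OF additive_symfun_coeff]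
  using assms by (auto simp: homogeneous_def elim!: sum.not_neutral_contains_not_neutral)

lemma homogeneous_of_int_times: "homogeneous d f \<Longrightarrow> homogeneous d (of_int c * f)"
  by (auto simp: homogeneous_def additive_of_int_times[OF additive_symfun_coeff])

text \<open>In every term of the Leibniz expansion the indices have the same sum, because permuting
  the columns does not change the sum of their brackets.\<close>

lemma homogeneous_jacobi_trudi: "homogeneous (\<Sum>i<n. int (part \<alpha> i)) (jacobi_trudi n \<alpha> 0)"
  unfolding jacobi_trudi_expand complete_prod_def
proof (intro homogeneous_sum homogeneous_of_int_times)
  fix \<sigma> assume "\<sigma> \<in> {\<sigma>. \<sigma> permutes {..<n}}"
  then have \<sigma>: "\<sigma> permutes {..<n}" by simp
  have "(\<Sum>i<n. bracket \<alpha> i - bracket 0 (\<sigma> i)) = (\<Sum>i<n. bracket \<alpha> i) - (\<Sum>i<n. bracket 0 (\<sigma> i))"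
    by (rule sum_subtractf)
  also have "(\<Sum>i<n. bracket 0 (\<sigma> i)) = (\<Sum>i<n. bracket 0 i)"
    using sum.permute[OF \<sigma>, of "bracket 0"] by (simp add: o_def)
  also have "(\<Sum>i<n. bracket \<alpha> i) - (\<Sum>i<n. bracket 0 i) = (\<Sum>i<n. int (part \<alpha> i))"
    unfolding sum_subtractf[symmetric] by (rule sum.cong) (auto simp: bracket_def)
  finally show "homogeneous (\<Sum>i<n. int (part \<alpha> i))
      (\<Prod>i<n. complete_h (bracket \<alpha> i - bracket 0 (\<sigma> i)))"
    using homogeneous_prod[of "{..<n}" "\<lambda>i. bracket \<alpha> i - bracket 0 (\<sigma> i)"
        "\<lambda>i. complete_h (bracket \<alpha> i - bracket 0 (\<sigma> i))"]
    by (simp add: homogeneous_complete_h)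
qed

lemma total_degree_compositions_in:
  assumes "\<alpha> \<in> compositions_in n"
  shows "total_degree \<alpha> = (\<Sum>i<n. part \<alpha> i)"
  using assms by (intro total_degree_superset) (auto simp: compositions_in_iff_keys)

text \<open>A nonzero part i forces the parts 0 to i to be at least 1, hence a degree of at least i
  + 1. This supplies a canonical number of variables for each partition.\<close>

lemma partition_in_compositions_in:
  assumes "\<alpha> \<in> partitions"
  shows "\<alpha> \<in> compositions_in (total_degree \<alpha>)"
  unfolding compositions_in_def
proof (intro CollectI allI impI, rule ccontr)
  fix i assume i: "total_degree \<alpha> \<le> i" "part \<alpha> i \<noteq> 0"
  have "Suc i = (\<Sum>j\<le>i. 1)" by simp
  also have "\<dots> \<le> (\<Sum>j\<le>i. part \<alpha> j)"
  proof (rule sum_mono)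
    fix j assume "j \<in> {..i}"
    then have "part \<alpha> i \<le> part \<alpha> j" using assms by (simp add: partitions_def)
    then show "1 \<le> part \<alpha> j" using i by simp
  qed
  also have "\<dots> \<le> (\<Sum>j\<in>{..i} \<union> Poly_Mapping.keys \<alpha>. part \<alpha> j)"
    by (rule sum_mono2) auto
  also have "\<dots> = total_degree \<alpha>"
    by (rule total_degree_superset[symmetric]) auto
  finally show False using i by simp
qed

lemma homogeneous_schur:
  assumes "\<alpha> \<in> partitions"
  shows "homogeneous (int (total_degree \<alpha>)) (schur \<alpha>)"
proof -
  obtain n where n: "\<alpha> \<in> compositions_in n"
    using partition_in_compositions_in[OF assms] by blast
  show ?thesis
    using homogeneous_jacobi_trudi[of \<alpha> n]
    by (simp add: schur_eq_jacobi_trudi[OF assms n] total_degree_compositions_in[OF n])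
qed

text \<open>
  The coefficient of \<open>s\<^sub>\<nu>\<close> in the expansion of \<open>f\<close> is the coefficient of \<open>X\<^sup>\<nu>\<^sup>+\<^sup>\<delta>\<close> in
  \<open>a\<^sub>\<delta> f\<close>; any number \<open>n\<close> of variables with \<open>\<nu> \<in> \<nat>\<^sup>n\<close> gives the same value.
\<close>

definition schur_coeff :: "nat \<Rightarrow> composition \<Rightarrow> symfun \<Rightarrow> int" where
  "schur_coeff n \<nu> f =
    Poly_Mapping.lookup (truncate_vars n f * alternant n (staircase n)) (staircase n + \<nu>)"

lemma additive_schur_coeff: "additive (schur_coeff n \<nu>)"
  by unfold_locales (simp add: schur_coeff_def truncate_vars_add distrib_right lookup_add)

lemma schur_coeff_schur:
  assumes "\<nu> \<in> partitions" "\<nu> \<in> compositions_in n" "\<mu> \<in> partitions"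
  shows "schur_coeff n \<nu> (schur \<mu>) = (if \<nu> = \<mu> then 1 else 0)"
  using assms
  by (cases "\<mu> \<in> compositions_in n") (auto simp: schur_coeff_def truncate_schur_eq_0
      truncate_schur_times_alternant lookup_alternant_staircase_add)

text \<open>Below n a shifted exponent is its bracket plus n, and n cancels. This is how the indices
  of the determinant arise from exponents.\<close>

lemma staircase_add_diff:
  assumes "\<sigma> permutes {..<n}" "i < n"
  shows "int (part (staircase n + \<alpha>) i) - int (part (staircase n + \<beta>) (\<sigma> i)) =
    bracket \<alpha> i - bracket \<beta> (\<sigma> i)"
  using permutes_in_image[OF assms(1), of i] assms(2)
  by (simp add: lookup_add lookup_staircase bracket_def)

lemma zcoeff_cong:
  assumes "\<And>i. i < n \<Longrightarrow> y i = z i"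
  shows "zcoeff n y f = zcoeff n z f"
proof -
  have "exponent_vec n y = exponent_vec n z"
    using assms by (auto intro!: poly_mapping_eqI simp: lookup_exponent_vec)
  moreover have "(\<forall>i<n. 0 \<le> y i) \<longleftrightarrow> (\<forall>i<n. 0 \<le> z i)" using assms by simp
  ultimately show ?thesis unfolding zcoeff_def by presburger
qed

lemma lookup_truncate_times_alternant_staircase_add:
  assumes "\<alpha> \<in> compositions_in n"
  shows "Poly_Mapping.lookup (truncate_vars n f * alternant n (staircase n + \<beta>)) (staircase n + \<alpha>) =
    (\<Sum>\<sigma> | \<sigma> permutes {..<n}. sign \<sigma> * zcoeff n (\<lambda>i. bracket \<alpha> i - bracket \<beta> (\<sigma> i)) f)"
proof -
  have "Poly_Mapping.lookup (truncate_vars n f * alternant n (staircase n + \<beta>)) (staircase n + \<alpha>) =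
    (\<Sum>\<sigma> | \<sigma> permutes {..<n}. sign \<sigma> * zcoeff n
      (\<lambda>i. int (part (staircase n + \<alpha>) i) - int (part (staircase n + \<beta>) (\<sigma> i))) f)"
    using assms by (intro lookup_truncate_times_alternant) (simp add: staircase_add_in_compositions_in)
  also have "\<dots> = (\<Sum>\<sigma> | \<sigma> permutes {..<n}. sign \<sigma> * zcoeff n (\<lambda>i. bracket \<alpha> i - bracket \<beta> (\<sigma> i)) f)"
    by (intro sum.cong refl arg_cong2[of _ _ _ _ "(*)"] zcoeff_cong staircase_add_diff) auto
  finally show ?thesis .
qed

lemma schur_coeff_expand:
  assumes "\<nu> \<in> compositions_in n"
  shows "schur_coeff n \<nu> f =
    (\<Sum>\<sigma> | \<sigma> permutes {..<n}. sign \<sigma> * zcoeff n (\<lambda>i. bracket \<nu> i - bracket 0 (\<sigma> i)) f)"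
  using lookup_truncate_times_alternant_staircase_add[OF assms, of f 0] by (simp add: schur_coeff_def)

section \<open>Leading exponents and criteria for vanishing\<close>

lemma composition_lessI:
  assumes "part \<alpha> i < part \<beta> i" "\<And>k. k < i \<Longrightarrow> part \<alpha> k = part \<beta> k"
  shows "\<alpha> < \<beta>"
  using assms unfolding less_poly_mapping.rep_eq less_fun_def by blast

lemma symfun_coeff_map_key:
  assumes "bij \<pi>"
  shows "symfun_coeff f (Poly_Mapping.map_key \<pi> m) = symfun_coeff f m"
  using symfun_coeff[of f] assms by (auto simp: symmetric_series_def)

text \<open>
  The lexicographically largest exponent \<open>\<nu>\<close> of a non-zero symmetric polynomial \<open>g\<close> is a partition,
  and in \<open>a\<^sub>\<delta> g\<close> only the diagonal term of \<open>a\<^sub>\<delta>\<close> contributes to the exponent \<open>\<nu> + \<delta>\<close>.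
\<close>

lemma truncate_vars_eq_0:
  assumes zero: "\<And>\<nu>. \<nu> \<in> partitions \<Longrightarrow> \<nu> \<in> compositions_in n \<Longrightarrow> schur_coeff n \<nu> g = 0"
  shows "truncate_vars n g = 0"
proof (rule ccontr)
  let ?S = "Poly_Mapping.keys (truncate_vars n g)"
  assume "truncate_vars n g \<noteq> 0"
  then have ne: "?S \<noteq> {}" by simp
  define \<nu> where "\<nu> = Max ?S"
  have "\<nu> \<in> ?S" unfolding \<nu>_def by (rule Max_in) (use ne in auto)
  then have \<nu>: "Poly_Mapping.keys \<nu> \<subseteq> {..<n}" "symfun_coeff g \<nu> \<noteq> 0"
    by (auto simp: in_keys_iff[of _ "truncate_vars n g"] lookup_truncate_vars split: if_splits)
  have max: "symfun_coeff g m = 0" if "Poly_Mapping.keys m \<subseteq> {..<n}" "\<nu> < m" for m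
  proof (rule ccontr)
    assume "symfun_coeff g m \<noteq> 0"
    then have "m \<in> ?S" using that by (simp add: in_keys_iff[of _ "truncate_vars n g"] lookup_truncate_vars)
    then have "m \<le> \<nu>" unfolding \<nu>_def by simp
    with that show False by simp
  qed
  have \<nu>_in: "\<nu> \<in> compositions_in n"
    using \<nu>(1) by (simp add: compositions_in_iff_keys)
  have "\<nu> \<in> partitions"
    unfolding partitions_def
  proof (intro CollectI allI impI, rule ccontr)
    fix i j :: nat assume "i \<le> j" "\<not> part \<nu> j \<le> part \<nu> i"
    then have ij: "part \<nu> i < part \<nu> j" "i < j" by (auto simp: order.order_iff_strict)
    have "j < n" by (rule ccontr) (use \<nu>_in ij in \<open>simp add: compositions_in_def\<close>)
    \<comment> \<open>The order on exponents is decided at the first index where they differ.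
      Exchanging the entries moves the larger one forward, so \<open>m\<close> lies above \<nu>, yet
      has the same coefficient by symmetry.\<close>
    define m where "m = Poly_Mapping.map_key (transpose i j) \<nu>"
    have m: "part m k = part \<nu> (transpose i j k)" for k
      by (simp add: m_def map_key.rep_eq)
    have "\<nu> < m"
      by (rule composition_lessI[of _ i]) (use ij in \<open>auto simp: m transpose_def\<close>)
    moreover have "Poly_Mapping.keys m \<subseteq> {..<n}"
    proof
      fix k assume "k \<in> Poly_Mapping.keys m"
      then have "transpose i j k \<in> Poly_Mapping.keys \<nu>" by (simp add: in_keys_iff m)
      then have "transpose i j k < n" using \<nu>(1) by blast
      then show "k \<in> {..<n}" using \<open>j < n\<close> ij by (auto simp: transpose_def split: if_splits)
    qed
    ultimately have "symfun_coeff g m = 0" by (intro max)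
    then show False using \<nu>(2) by (simp add: m_def symfun_coeff_map_key)
  qed
  then have "schur_coeff n \<nu> g = 0" using zero \<nu>_in by blast
  moreover have "schur_coeff n \<nu> g = symfun_coeff g \<nu>"
  proof -
    let ?z = "\<lambda>\<sigma> i. bracket \<nu> i - bracket 0 (\<sigma> i)"
    have "zcoeff n (?z \<sigma>) g = 0" if \<sigma>: "\<sigma> permutes {..<n}" "\<sigma> \<noteq> id" for \<sigma>
    proof -
      \<comment> \<open>At the first index moved by \<sigma>, the exponent exceeds that of \<nu> by
        \<sigma> i - i > 0, and earlier entries agree with \<nu>. It thus lies above the maximum
        \<nu>.\<close>
      define i where "i = (LEAST i. \<sigma> i \<noteq> i)"
      have "\<exists>i. \<sigma> i \<noteq> i" using \<sigma>(2) by (auto simp: fun_eq_iff)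
      then have i: "\<sigma> i \<noteq> i" unfolding i_def by (rule LeastI_ex)
      have fix_less: "\<sigma> k = k" if "k < i" for k
        using not_less_Least[of k "\<lambda>i. \<sigma> i \<noteq> i"] that by (auto simp: i_def)
      have "i < n" using i \<sigma>(1) by (metis lessThan_iff permutes_not_in)
      have "\<not> \<sigma> i < i"
        using fix_less[of "\<sigma> i"] injD[OF permutes_inj[OF \<sigma>(1)], of "\<sigma> i" i] i by blast
      with i have "i < \<sigma> i" by simp
      then have "\<nu> < exponent_vec n (?z \<sigma>)"
        using \<open>i < n\<close>
        by (intro composition_lessI[of _ i]) (auto simp: lookup_exponent_vec bracket_def fix_less)
      moreover have "Poly_Mapping.keys (exponent_vec n (?z \<sigma>)) \<subseteq> {..<n}"
        by (auto simp: in_keys_iff lookup_exponent_vec split: if_splits)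
      ultimately show ?thesis by (simp add: zcoeff_def max)
    qed
    then have "schur_coeff n \<nu> g = (\<Sum>\<sigma>\<in>{id}. sign \<sigma> * zcoeff n (?z \<sigma>) g)"
      unfolding schur_coeff_expand[OF \<nu>_in]
      by (intro sum.mono_neutral_right) (auto simp: permutes_id finite_permutations)
    also have "\<dots> = zcoeff n (\<lambda>i. int (part \<nu> i)) g"
      by (simp add: bracket_def)
    also have "exponent_vec n (\<lambda>i. int (part \<nu> i)) = \<nu>"
      using \<nu>_in by (auto intro!: poly_mapping_eqI simp: lookup_exponent_vec compositions_in_def)
    then have "zcoeff n (\<lambda>i. int (part \<nu> i)) g = symfun_coeff g \<nu>"
      by (simp add: zcoeff_def)
    finally show ?thesis .
  qed
  ultimately show False using \<nu>(2) by simp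
qed

text \<open>\<open>symmetric_series\<close> speaks of bijections of all indices, so a bijection from
  A to B has to be extended: B - A goes to A - B, and everything else stays fixed.\<close>

lemma ex_bij_image:
  assumes "finite A" "finite B" "card A = card B"
  obtains \<pi> :: "'a \<Rightarrow> 'a" where "bij \<pi>" "\<pi> ` A = B"
proof -
  obtain f where f: "bij_betw f A B"
    using finite_same_card_bij[OF assms] by blast
  have "card (B - A) = card (A - B)"
    using assms by (metis card_Diff_subset_Int finite_Int inf_commute)
  then obtain g where g: "bij_betw g (B - A) (A - B)"
    using finite_same_card_bij[of "B - A" "A - B"] assms by auto
  define \<pi> where "\<pi> x = (if x \<in> A then f x else if x \<in> B - A then g x else x)" for x
  have "bij_betw \<pi> A B \<longleftrightarrow> bij_betw f A B" "bij_betw \<pi> (B - A) (A - B) \<longleftrightarrow> bij_betw g (B - A) (A - B)"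
      "bij_betw \<pi> (- (A \<union> B)) (- (A \<union> B)) \<longleftrightarrow> bij_betw id (- (A \<union> B)) (- (A \<union> B))"
    by (rule bij_betw_cong; simp add: \<pi>_def)+
  then have *: "bij_betw \<pi> A B" "bij_betw \<pi> (B - A) (A - B)" "bij_betw \<pi> (- (A \<union> B)) (- (A \<union> B))"
    using f g by simp_all
  have "bij_betw \<pi> (A \<union> (B - A)) (B \<union> (A - B))"
    by (rule bij_betw_combine[OF *(1,2)]) auto
  then have "bij_betw \<pi> (A \<union> (B - A) \<union> - (A \<union> B)) (B \<union> (A - B) \<union> - (A \<union> B))"
    by (rule bij_betw_combine[OF _ *(3)]) auto
  moreover have "A \<union> (B - A) \<union> - (A \<union> B) = UNIV" "B \<union> (A - B) \<union> - (A \<union> B) = UNIV"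
    by auto
  ultimately have "bij \<pi>" by simp
  moreover have "\<pi> ` A = B" using *(1) by (simp add: bij_betw_def)
  ultimately show ?thesis by (rule that)
qed

text \<open>A monomial of degree at most d involves at most d indeterminates, and symmetry moves
  them into the first d places, where the truncation sees the coefficient.\<close>

lemma symfun_eq_0I:
  assumes deg: "\<And>m. symfun_coeff f m \<noteq> 0 \<Longrightarrow> total_degree m \<le> d" and "truncate_vars d f = 0"
  shows "f = 0"
proof -
  have "symfun_coeff f m = 0" for m
  proof (cases "total_degree m \<le> d")
    case True
    define k where "k = card (Poly_Mapping.keys m)"
    have "k = (\<Sum>i\<in>Poly_Mapping.keys m. 1)" by (simp add: k_def)
    also have "\<dots> \<le> total_degree m"
      unfolding total_degree_def by (rule sum_mono) (auto simp: in_keys_iff Suc_le_eq)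
    finally have k: "{..<k} \<subseteq> {..<d}" using True by auto
    obtain \<pi> where \<pi>: "bij \<pi>" "\<pi> ` {..<k} = Poly_Mapping.keys m"
      using ex_bij_image[of "{..<k}" "Poly_Mapping.keys m"] by (auto simp: k_def)
    have "Poly_Mapping.keys (Poly_Mapping.map_key \<pi> m) = \<pi> -` Poly_Mapping.keys m"
      using \<pi>(1) by (simp add: keys_map_key bij_is_inj)
    also have "\<dots> = {..<k}"
      using \<pi>(1) by (simp add: \<pi>(2)[symmetric] inj_vimage_image_eq bij_is_inj)
    finally have "symfun_coeff f (Poly_Mapping.map_key \<pi> m) =
        Poly_Mapping.lookup (truncate_vars d f) (Poly_Mapping.map_key \<pi> m)"
      using k by (simp add: lookup_truncate_vars)
    then show ?thesis using \<pi>(1) assms(2) by (simp add: symfun_coeff_map_key)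
  qed (use deg in blast)
  then show ?thesis by (simp add: symfun_coeff_inject[symmetric] fun_eq_iff zero_symfun.rep_eq)
qed

text \<open>All exponents at which \<open>schur_coeff_expand\<close> evaluates f have the total
  degree of \<nu>.\<close>

lemma schur_coeff_eq_0:
  assumes "\<nu> \<in> compositions_in n"
    and "\<And>m. symfun_coeff f m \<noteq> 0 \<Longrightarrow> total_degree m \<le> d" and "d < total_degree \<nu>"
  shows "schur_coeff n \<nu> f = 0"
proof -
  have "zcoeff n (\<lambda>i. bracket \<nu> i - bracket 0 (\<sigma> i)) f = 0" if \<sigma>: "\<sigma> permutes {..<n}" for \<sigma>
  proof (cases "\<forall>i<n. 0 \<le> bracket \<nu> i - bracket 0 (\<sigma> i)")
    case True
    let ?m = "exponent_vec n (\<lambda>i. bracket \<nu> i - bracket 0 (\<sigma> i))"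
    have "?m \<in> compositions_in n"
      by (simp add: compositions_in_def lookup_exponent_vec)
    then have "int (total_degree ?m) = (\<Sum>i<n. bracket \<nu> i - bracket 0 (\<sigma> i))"
      using True by (subst total_degree_compositions_in)
        (auto simp: lookup_exponent_vec intro!: sum.cong)
    also have "\<dots> = (\<Sum>i<n. bracket \<nu> i) - (\<Sum>i<n. bracket 0 (\<sigma> i))"
      by (rule sum_subtractf)
    also have "(\<Sum>i<n. bracket 0 (\<sigma> i)) = (\<Sum>i<n. bracket 0 i)"
      using sum.permute[OF \<sigma>, of "bracket 0"] by (simp add: o_def)
    also have "(\<Sum>i<n. bracket \<nu> i) - (\<Sum>i<n. bracket 0 i) = (\<Sum>i<n. int (part \<nu> i))"
      unfolding sum_subtractf[symmetric] by (rule sum.cong) (auto simp: bracket_def)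
    also have "\<dots> = int (total_degree \<nu>)"
      by (simp add: total_degree_compositions_in[OF assms(1)])
    finally have "symfun_coeff f ?m = 0" using assms(2)[of ?m] assms(3) by fastforce
    then show ?thesis by (simp add: zcoeff_def)
  qed (simp add: zcoeff_def del: not_all)
  then show ?thesis by (simp add: schur_coeff_expand[OF assms(1)])
qed

text \<open>The degree bound d of f also serves as the number of variables: partitions of degree at
  most d have at most d parts, and a remainder of degree at most d vanishes once its truncation to d
  variables does.\<close>

lemma schur_expansion:
  obtains S c where "finite S" "S \<subseteq> partitions" "f = (\<Sum>\<nu>\<in>S. of_int (c \<nu>) * schur \<nu>)"
proof -
  obtain d where d: "\<And>m. symfun_coeff f m \<noteq> 0 \<Longrightarrow> total_degree m \<le> d"
    using symfun_coeff[of f] by (auto simp: bounded_degree_def)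
  define S where "S = {\<nu> \<in> partitions. total_degree \<nu> \<le> d}"
  define c where "c \<nu> = schur_coeff d \<nu> f" for \<nu>
  have S_in: "\<nu> \<in> compositions_in d" if "\<nu> \<in> S" for \<nu>
    using that partition_in_compositions_in[of \<nu>] by (auto simp: S_def compositions_in_def)
  then have "S \<subseteq> {m. Poly_Mapping.keys m \<subseteq> {..<d} \<and> total_degree m \<le> d}"
    by (auto simp: S_def compositions_in_iff_keys)
  then have fin: "finite S"
    by (rule finite_subset) (simp add: finite_exponents)
  define g where "g = f - (\<Sum>\<nu>\<in>S. of_int (c \<nu>) * schur \<nu>)"
  have "truncate_vars d g = 0"
  proof (rule truncate_vars_eq_0)
    fix \<nu> assume \<nu>: "\<nu> \<in> partitions" "\<nu> \<in> compositions_in d"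
    have "schur_coeff d \<nu> g = schur_coeff d \<nu> f - (\<Sum>\<mu>\<in>S. c \<mu> * schur_coeff d \<nu> (schur \<mu>))"
      by (simp add: g_def additive.diff[OF additive_schur_coeff] additive.sum[OF additive_schur_coeff]
          additive_of_int_times[OF additive_schur_coeff])
    also have "(\<Sum>\<mu>\<in>S. c \<mu> * schur_coeff d \<nu> (schur \<mu>)) = (\<Sum>\<mu>\<in>S. if \<nu> = \<mu> then c \<mu> else 0)"
      using \<nu> by (intro sum.cong) (auto simp: schur_coeff_schur S_def)
    also have "\<dots> = (if \<nu> \<in> S then c \<nu> else 0)"
      using fin by simp
    \<comment> \<open>For \<nu> in \<open>S\<close> the two terms cancel. Any other \<nu> has degree
      above d, so the coefficient of f is already 0.\<close>
    finally show "schur_coeff d \<nu> g = 0"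
      using \<nu> schur_coeff_eq_0[of \<nu> d f d] d by (auto simp: c_def S_def)
  qed
  moreover have "total_degree m \<le> d" if "symfun_coeff g m \<noteq> 0" for m
  proof (rule ccontr)
    assume m: "\<not> total_degree m \<le> d"
    then have "symfun_coeff (schur \<nu>) m = 0" if "\<nu> \<in> S" for \<nu>
      using homogeneous_schur[of \<nu>] that by (auto simp: S_def homogeneous_def)
    moreover have "symfun_coeff f m = 0" using d m by blast
    ultimately show False
      using that by (simp add: g_def additive.diff[OF additive_symfun_coeff]
          additive.sum[OF additive_symfun_coeff] additive_of_int_times[OF additive_symfun_coeff])
  qed
  ultimately have "g = 0" by (intro symfun_eq_0I[of g d]) auto
  then show ?thesis using that[of S c] fin by (simp add: g_def S_def)
qed

lemma additive_eq_on_schur: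
  fixes F G :: "symfun \<Rightarrow> int"
  assumes "additive F" "additive G" "\<And>\<nu>. \<nu> \<in> partitions \<Longrightarrow> F (schur \<nu>) = G (schur \<nu>)"
  shows "F f = G f"
proof -
  obtain S c where S: "S \<subseteq> partitions" "f = (\<Sum>\<nu>\<in>S. of_int (c \<nu>) * schur \<nu>)"
    by (rule schur_expansion)
  then show ?thesis
    using assms(3) by (auto simp: additive.sum[OF assms(1)] additive.sum[OF assms(2)]
        additive_of_int_times[OF assms(1)] additive_of_int_times[OF assms(2)] subset_iff intro!: sum.cong)
qed

text \<open>Both sides are additive in f and agree on Schur functions, so alternants of different
  sizes need not be compared.\<close>

lemma schur_coeff_size_indep:
  assumes "\<nu> \<in> partitions" "\<nu> \<in> compositions_in n"
  shows "schur_coeff (total_degree \<nu>) \<nu> f = schur_coeff n \<nu> f"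
  by (rule additive_eq_on_schur[OF additive_schur_coeff additive_schur_coeff])
    (simp add: schur_coeff_schur assms partition_in_compositions_in[OF assms(1)])

lemma eq_0_if_schur_coeffs_0:
  assumes "\<And>\<nu>. \<nu> \<in> partitions \<Longrightarrow> schur_coeff (total_degree \<nu>) \<nu> f = 0"
  shows "f = 0"
proof (rule symfun_eqI)
  fix n
  have "truncate_vars n f = 0"
    by (rule truncate_vars_eq_0) (metis assms schur_coeff_size_indep)
  then show "truncate_vars n f = truncate_vars n 0" by simp
qed

section \<open>The scalar product\<close>

definition schur_support :: "symfun \<Rightarrow> composition set" where
  "schur_support f = {\<nu> \<in> partitions. schur_coeff (total_degree \<nu>) \<nu> f \<noteq> 0}"

text \<open>The sum of products of coordinates in the Schur basis. Restricting it to the support of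
  the first argument makes it finite; the number of variables is the canonical one for each
  \<nu>.\<close>

definition schur_form :: "symfun \<Rightarrow> symfun \<Rightarrow> int" where
  "schur_form f g = (\<Sum>\<nu>\<in>schur_support f.
    schur_coeff (total_degree \<nu>) \<nu> f * schur_coeff (total_degree \<nu>) \<nu> g)"

lemma finite_schur_support: "finite (schur_support f)"
proof -
  obtain S c where S: "finite S" "S \<subseteq> partitions" "f = (\<Sum>\<nu>\<in>S. of_int (c \<nu>) * schur \<nu>)"
    by (rule schur_expansion)
  have "\<nu> \<in> S" if \<nu>: "\<nu> \<in> schur_support f" for \<nu>
  proof (rule ccontr)
    assume "\<nu> \<notin> S"
    moreover have "\<nu> \<in> partitions" using \<nu> by (simp add: schur_support_def)
    ultimately have "schur_coeff (total_degree \<nu>) \<nu> (schur \<mu>) = 0" if "\<mu> \<in> S" for \<mu>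
      using S(2) that partition_in_compositions_in[of \<nu>] by (subst schur_coeff_schur) auto
    then show False
      using \<nu> unfolding schur_support_def S(3)
      by (simp add: additive.sum[OF additive_schur_coeff] additive_of_int_times[OF additive_schur_coeff])
  qed
  then show ?thesis using S(1) by (meson finite_subset subsetI)
qed

lemma schur_form_eq:
  assumes "finite T" "schur_support f \<subseteq> T" "T \<subseteq> partitions"
  shows "schur_form f g = (\<Sum>\<nu>\<in>T. schur_coeff (total_degree \<nu>) \<nu> f * schur_coeff (total_degree \<nu>) \<nu> g)"
  unfolding schur_form_def using assms
  by (intro sum.mono_neutral_left) (auto simp: schur_support_def)

lemma symmetric_bilinear_schur_form: "symmetric_bilinear schur_form"
  unfolding symmetric_bilinear_def
proof (intro conjI allI)
  fix f g h
  \<comment> \<open>A common summation range reduces symmetry and additivity to single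
    terms.\<close>
  let ?T = "schur_support f \<union> schur_support g \<union> schur_support (f + g)"
  have T: "finite ?T" "?T \<subseteq> partitions"
    by (auto simp: finite_schur_support) (auto simp: schur_support_def)
  have eq: "schur_form k k' = (\<Sum>\<nu>\<in>?T. schur_coeff (total_degree \<nu>) \<nu> k * schur_coeff (total_degree \<nu>) \<nu> k')"
    if "k \<in> {f, g, f + g}" for k k'
    by (rule schur_form_eq) (use T that in auto)
  show "schur_form f g = schur_form g f"
    by (simp add: eq mult.commute)
  show "schur_form (f + g) h = schur_form f h + schur_form g h"
    by (simp add: eq additive.add[OF additive_schur_coeff] distrib_right sum.distrib)
qed

lemma schur_form_schur:
  assumes "\<nu> \<in> partitions"
  shows "schur_form (schur \<nu>) f = schur_coeff (total_degree \<nu>) \<nu> f"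
proof -
  have "schur_support (schur \<nu>) \<subseteq> {\<nu>}"
    using assms partition_in_compositions_in
    by (auto simp: schur_support_def schur_coeff_schur split: if_splits)
  then show ?thesis
    using schur_form_eq[of "{\<nu>}" "schur \<nu>" f] assms partition_in_compositions_in[OF assms]
    by (simp add: schur_coeff_schur)
qed

lemma additive_symmetric_bilinear:
  assumes "symmetric_bilinear B"
  shows "additive (B f)" "additive (\<lambda>f. B f g)"
proof -
  have comm: "B f g = B g f" and add: "B (f + g) h = B f h + B g h" for f g h
    using assms unfolding symmetric_bilinear_def by blast+
  show "additive (\<lambda>f. B f g)" by unfold_locales (rule add)
  show "additive (B f)" by unfold_locales (metis comm add)
qed

text \<open>Uniqueness applies the spanning of Schur functions twice: in the second argument while
  the first is a Schur function, and after that in the first.\<close>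

lemma scalar_product_eq_schur_form: "scalar_product = schur_form"
  unfolding scalar_product_def
proof (rule the_equality)
  show "symmetric_bilinear schur_form \<and> (\<forall>lam\<in>partitions. \<forall>mu\<in>partitions.
      schur_form (schur lam) (schur mu) = (if lam = mu then 1 else 0))"
    by (simp add: symmetric_bilinear_schur_form schur_form_schur schur_coeff_schur
        partition_in_compositions_in)
next
  fix B assume "symmetric_bilinear B \<and> (\<forall>lam\<in>partitions. \<forall>mu\<in>partitions.
      B (schur lam) (schur mu) = (if lam = mu then 1 else 0))"
  then have B: "symmetric_bilinear B"
    and orth: "\<And>\<nu> \<mu>. \<nu> \<in> partitions \<Longrightarrow> \<mu> \<in> partitions \<Longrightarrow> B (schur \<nu>) (schur \<mu>) = (if \<nu> = \<mu> then 1 else 0)"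
    by blast+
  note add = additive_symmetric_bilinear[OF B]
    additive_symmetric_bilinear[OF symmetric_bilinear_schur_form]
  have "B (schur \<nu>) g = schur_form (schur \<nu>) g" if "\<nu> \<in> partitions" for \<nu> g
    by (rule additive_eq_on_schur[OF add(1,3)])
      (simp add: that orth schur_form_schur schur_coeff_schur partition_in_compositions_in)
  then have "B f g = schur_form f g" for f g
    by (rule additive_eq_on_schur[OF add(2,4)])
  then show "B = schur_form" by (simp add: fun_eq_iff)
qed

lemma scalar_product_schur:
  assumes "\<nu> \<in> partitions" "\<nu> \<in> compositions_in n"
  shows "scalar_product (schur \<nu>) f = schur_coeff n \<nu> f"
  using assms by (simp add: scalar_product_eq_schur_form schur_form_schur schur_coeff_size_indep)

lemma scalar_product_commute: "scalar_product f g = scalar_product g f"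
  using symmetric_bilinear_schur_form by (simp add: scalar_product_eq_schur_form symmetric_bilinear_def)

lemma additive_scalar_product: "additive (scalar_product f)" "additive (\<lambda>f. scalar_product f g)"
  using additive_symmetric_bilinear[OF symmetric_bilinear_schur_form]
  by (simp_all add: scalar_product_eq_schur_form)

text \<open>Pairing with s_\<nu> reads off the coordinate at \<nu>, and an element with all
  coordinates 0 is 0.\<close>

lemma scalar_product_nondegenerate:
  assumes "\<And>f. scalar_product g f = scalar_product h f"
  shows "g = h"
proof -
  have "g - h = 0"
  proof (rule eq_0_if_schur_coeffs_0)
    fix \<nu> assume \<nu>: "\<nu> \<in> partitions"
    have "schur_coeff (total_degree \<nu>) \<nu> (g - h) = scalar_product (g - h) (schur \<nu>)"
      using scalar_product_schur[OF \<nu> partition_in_compositions_in[OF \<nu>]]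
      by (simp add: scalar_product_commute[of _ "schur \<nu>"])
    then show "schur_coeff (total_degree \<nu>) \<nu> (g - h) = 0"
      using assms by (simp add: additive.diff[OF additive_scalar_product(2)])
  qed
  then show ?thesis by simp
qed

section \<open>Duality of complete and monomial functions\<close>

text \<open>The ways to obtain X^b by choosing one monomial from each factor h. Fixing the value 0
  from n on makes each choice a single function, so that \<open>card\<close> counts choices.\<close>

definition monomial_tuples :: "nat \<Rightarrow> (nat \<Rightarrow> int) \<Rightarrow> composition \<Rightarrow> (nat \<Rightarrow> composition) set" where
  "monomial_tuples n z b = {F. (\<forall>i\<ge>n. F i = 0) \<and> (\<forall>i<n. int (total_degree (F i)) = z i) \<and>
    (\<Sum>i<n. F i) = b}"

text \<open>Splits off the last factor: q is its monomial and p the product of the others.\<close>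

lemma bij_betw_monomial_tuples_Suc:
  "bij_betw (\<lambda>F. ((\<Sum>i<n. F i, F n), F(n := 0))) (monomial_tuples (Suc n) z b)
    (SIGMA (p, q) : {(p, q). p + q = b \<and> int (total_degree q) = z n}. monomial_tuples n z p)"
proof (rule bij_betw_byWitness[where f' = "\<lambda>((p, q), F). F(n := q)"])
  have cong: "(\<Sum>i<n. (F(n := q)) i) = (\<Sum>i<n. F i)" for F :: "nat \<Rightarrow> composition" and q
    by (rule sum.cong) auto
  show "(\<lambda>F. ((\<Sum>i<n. F i, F n), F(n := 0))) ` monomial_tuples (Suc n) z b \<subseteq>
      (SIGMA (p, q) : {(p, q). p + q = b \<and> int (total_degree q) = z n}. monomial_tuples n z p)"
    by (auto simp: monomial_tuples_def cong simp del: fun_upd_apply) (auto simp: le_Suc_eq)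
  show "(\<lambda>((p, q), F). F(n := q)) `
      (SIGMA (p, q) : {(p, q). p + q = b \<and> int (total_degree q) = z n}. monomial_tuples n z p) \<subseteq>
      monomial_tuples (Suc n) z b"
    by (auto simp: monomial_tuples_def cong simp del: fun_upd_apply) (auto simp: less_Suc_eq)
  show "\<forall>F\<in>monomial_tuples (Suc n) z b.
      (\<lambda>((p, q), F). F(n := q)) ((\<Sum>i<n. F i, F n), F(n := 0)) = F"
    by simp
  show "\<forall>x\<in>SIGMA (p, q) : {(p, q). p + q = b \<and> int (total_degree q) = z n}. monomial_tuples n z p.
      (\<lambda>F. ((\<Sum>i<n. F i, F n), F(n := 0))) ((\<lambda>((p, q), F). F(n := q)) x) = x"
    by (auto simp: monomial_tuples_def cong simp del: fun_upd_apply) auto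
qed

text \<open>Every coefficient of an h is 0 or 1, so a coefficient of the product is a count.
  Finiteness is part of the induction because the cardinality of the disjoint union relies on
  it.\<close>

lemma symfun_coeff_complete_prod:
  "finite (monomial_tuples n z b) \<and>
    symfun_coeff (complete_prod n z) b = int (card (monomial_tuples n z b))"
proof (induction n arbitrary: b)
  case 0
  have "monomial_tuples 0 z b = (if b = 0 then {\<lambda>_. 0} else {})"
    by (auto simp: monomial_tuples_def)
  then show ?case by (simp add: complete_prod_def one_symfun.rep_eq)
next
  case (Suc n)
  let ?D = "{(p, q). p + q = b \<and> int (total_degree q) = z n}"
  have D: "finite ?D" by (rule finite_subset[OF _ finite_decompositions[of b]]) auto
  note bij = bij_betw_monomial_tuples_Suc[of n z b]
  have fin: "\<forall>x\<in>?D. finite (case x of (p, q) \<Rightarrow> monomial_tuples n z p)"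
    using Suc by auto
  have "symfun_coeff (complete_prod (Suc n) z) b =
      (\<Sum>(p, q)\<in>{(p, q). p + q = b}. symfun_coeff (complete_prod n z) p * symfun_coeff (complete_h (z n)) q)"
    by (simp add: complete_prod_def times_symfun.rep_eq series_times_def)
  also have "\<dots> = (\<Sum>(p, q)\<in>?D. symfun_coeff (complete_prod n z) p * symfun_coeff (complete_h (z n)) q)"
    by (rule sum.mono_neutral_right) (auto simp: finite_decompositions symfun_coeff_complete_h split: if_splits)
  also have "\<dots> = (\<Sum>x\<in>?D. int (card (case x of (p, q) \<Rightarrow> monomial_tuples n z p)))"
    by (rule sum.cong) (auto simp: Suc symfun_coeff_complete_h)
  also have "\<dots> = int (card (SIGMA (p, q) : ?D. monomial_tuples n z p))"
    using D fin by (subst card_SigmaI) auto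
  also have "card (SIGMA (p, q) : ?D. monomial_tuples n z p) = card (monomial_tuples (Suc n) z b)"
    by (rule bij_betw_same_card[OF bij, symmetric])
  finally show ?case
    using bij_betw_finite[OF bij] finite_SigmaI[OF D, of "\<lambda>(p, q). monomial_tuples n z p"] fin
    by auto
qed

text \<open>The margins are integers so that a negative one leaves no table, in agreement with the
  conventions for \<open>complete_h\<close> and \<open>zcoeff\<close>.\<close>

definition contingency_tables :: "nat \<Rightarrow> (nat \<Rightarrow> int) \<Rightarrow> nat \<Rightarrow> (nat \<Rightarrow> int) \<Rightarrow> (nat \<Rightarrow> nat \<Rightarrow> nat) set" where
  "contingency_tables n z k w = {M. (\<forall>i j. i \<ge> n \<or> j \<ge> k \<longrightarrow> M i j = 0) \<and>
    (\<forall>i<n. (\<Sum>j<k. int (M i j)) = z i) \<and> (\<forall>j<k. (\<Sum>i<n. int (M i j)) = w j)}"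

lemma card_contingency_tables_transpose:
  "card (contingency_tables n z k w) = card (contingency_tables k w n z)"
  by (rule bij_betw_same_card[of "\<lambda>M i j. M j i"],
      rule bij_betw_byWitness[where f' = "\<lambda>M i j. M j i"])
    (auto simp: contingency_tables_def)

text \<open>Row i of a table is the exponent of the monomial chosen from factor i: its row sum is
  the degree of that factor, and the column sums give the exponent of the product.\<close>

lemma zcoeff_complete_prod:
  "zcoeff k w (complete_prod n z) = int (card (contingency_tables n z k w))"
proof (cases "\<forall>j<k. 0 \<le> w j")
  case True
  let ?b = "exponent_vec k w"
  let ?f = "\<lambda>F i j. part (F i) j" and ?g = "\<lambda>M i. exponent_vec k (\<lambda>j. int (M i j))"
  have in_k: "F i \<in> compositions_in k" if F: "F \<in> monomial_tuples n z ?b" for F i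
    unfolding compositions_in_def
  proof (intro CollectI allI impI)
    fix j assume j: "k \<le> j"
    have "(\<Sum>i<n. F i) = ?b" using F by (simp add: monomial_tuples_def)
    then have "(\<Sum>i<n. part (F i) j) = part ?b j" by (simp flip: lookup_sum)
    then have "(\<Sum>i<n. part (F i) j) = 0" using j by (simp add: lookup_exponent_vec)
    then show "part (F i) j = 0"
      using F by (cases "i < n") (auto simp: monomial_tuples_def)
  qed
  have "bij_betw ?f (monomial_tuples n z ?b) (contingency_tables n z k w)"
  proof (rule bij_betw_byWitness[where f' = ?g])
    show "\<forall>F\<in>monomial_tuples n z ?b. ?g (?f F) = F"
      using in_k
      by (auto intro!: ext poly_mapping_eqI simp: lookup_exponent_vec compositions_in_def)
    show "\<forall>M\<in>contingency_tables n z k w. ?f (?g M) = M"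
      by (auto simp: lookup_exponent_vec contingency_tables_def fun_eq_iff)
    show "?f ` monomial_tuples n z ?b \<subseteq> contingency_tables n z k w"
    proof (intro image_subsetI)
      fix F assume F: "F \<in> monomial_tuples n z ?b"
      have "(\<Sum>i<n. part (F i) j) = part ?b j" for j
        using F by (auto simp: monomial_tuples_def simp flip: lookup_sum)
      then have "(\<Sum>i<n. int (part (F i) j)) = w j" if "j < k" for j
        using True that by (simp add: lookup_exponent_vec flip: of_nat_sum)
      moreover have "(\<Sum>j<k. int (part (F i) j)) = z i" if "i < n" for i
      proof -
        have "int (total_degree (F i)) = z i"
          using F that by (simp add: monomial_tuples_def)
        then show ?thesis by (simp add: total_degree_compositions_in[OF in_k[OF F]])
      qed
      moreover have "part (F i) j = 0" if "i \<ge> n \<or> j \<ge> k" for i j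
        using F in_k[OF F, of i] that by (auto simp: monomial_tuples_def compositions_in_def)
      ultimately show "?f F \<in> contingency_tables n z k w"
        by (simp add: contingency_tables_def)
    qed
    show "?g ` contingency_tables n z k w \<subseteq> monomial_tuples n z ?b"
    proof (intro image_subsetI)
      fix M assume M: "M \<in> contingency_tables n z k w"
      have in_k: "?g M i \<in> compositions_in k" for i
        by (simp add: compositions_in_def lookup_exponent_vec)
      have "int (total_degree (?g M i)) = (\<Sum>j<k. int (M i j))" for i
        by (simp add: total_degree_compositions_in[OF in_k] lookup_exponent_vec)
      moreover have "(\<Sum>i<n. ?g M i) = ?b"
      proof (rule poly_mapping_eqI)
        fix j
        show "part (\<Sum>i<n. ?g M i) j = part ?b j"
          using M by (auto simp: contingency_tables_def lookup_sum lookup_exponent_vec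
              simp flip: of_nat_sum)
      qed
      moreover have "?g M i = 0" if "i \<ge> n" for i
        using M that by (auto intro!: poly_mapping_eqI simp: contingency_tables_def lookup_exponent_vec)
      ultimately show "?g M \<in> monomial_tuples n z ?b"
        using M by (simp add: monomial_tuples_def contingency_tables_def)
    qed
  qed
  then show ?thesis
    using True by (simp add: zcoeff_def symfun_coeff_complete_prod bij_betw_same_card)
next
  case False
  have "contingency_tables n z k w = {}"
  proof (rule ccontr)
    assume "contingency_tables n z k w \<noteq> {}"
    then obtain M where "\<forall>j<k. (\<Sum>i<n. int (M i j)) = w j"
      by (auto simp: contingency_tables_def)
    moreover have "0 \<le> (\<Sum>i<n. int (M i j))" for j by (rule sum_nonneg) simp
    ultimately show False using False by metis
  qed
  then show ?thesis using False by (simp add: zcoeff_def del: not_all)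
qed

lemma zcoeff_complete_prod_commute:
  "zcoeff k w (complete_prod n z) = zcoeff n z (complete_prod k w)"
  using card_contingency_tables_transpose[of n z k w] by (simp add: zcoeff_complete_prod)

text \<open>
  The complete functions are dual to the monomial ones. On \<open>s\<^sub>\<nu>\<close> this is the Jacobi--Trudi identity
  for \<open>\<mu> = 0\<close> together with the symmetry \<open>[X\<^sup>w] h\<^sub>z = [X\<^sup>z] h\<^sub>w\<close>.
\<close>

lemma scalar_product_complete_prod: "scalar_product (complete_prod n z) f = zcoeff n z f"
proof (rule additive_eq_on_schur[OF additive_scalar_product(1) additive_zcoeff])
  fix \<nu> assume \<nu>: "\<nu> \<in> partitions"
  then obtain k where k: "\<nu> \<in> compositions_in k"
    using partition_in_compositions_in by blast
  let ?z = "\<lambda>\<sigma> i. bracket \<nu> i - bracket 0 (\<sigma> i)"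
  have "scalar_product (complete_prod n z) (schur \<nu>) = schur_coeff k \<nu> (complete_prod n z)"
    using scalar_product_schur[OF \<nu> k] by (simp add: scalar_product_commute[of _ "schur \<nu>"])
  also have "\<dots> = (\<Sum>\<sigma> | \<sigma> permutes {..<k}. sign \<sigma> * zcoeff n z (complete_prod k (?z \<sigma>)))"
    by (simp add: schur_coeff_expand[OF k] zcoeff_complete_prod_commute[of k _ n z])
  also have "\<dots> = zcoeff n z (jacobi_trudi k \<nu> 0)"
    by (simp add: jacobi_trudi_expand additive.sum[OF additive_zcoeff]
        additive_of_int_times[OF additive_zcoeff])
  also have "jacobi_trudi k \<nu> 0 = schur \<nu>"
    by (simp add: schur_eq_jacobi_trudi[OF \<nu> k])
  finally show "scalar_product (complete_prod n z) (schur \<nu>) = zcoeff n z (schur \<nu>)" .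
qed

section \<open>Skew Schur functions\<close>

lemma scalar_product_jacobi_trudi:
  assumes "lam \<in> partitions" "lam \<in> compositions_in l" "mu \<in> partitions" "mu \<in> compositions_in l"
  shows "scalar_product (jacobi_trudi l lam mu) f = scalar_product (schur lam) (schur mu * f)"
proof -
  have "scalar_product (schur lam) (schur mu * f) = schur_coeff l lam (schur mu * f)"
    using assms by (simp add: scalar_product_schur)
  \<comment> \<open>Grouping s_\<mu> with a_\<delta> produces the alternant of \<mu> + \<delta> and
    leaves f as the other factor.\<close>
  also have "truncate_vars l (schur mu * f) * alternant l (staircase l) =
      truncate_vars l f * (truncate_vars l (schur mu) * alternant l (staircase l))"
    by (simp only: truncate_vars_times mult_ac)
  then have "schur_coeff l lam (schur mu * f) =
      Poly_Mapping.lookup (truncate_vars l f * alternant l (staircase l + mu)) (staircase l + lam)"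
    using assms by (simp add: schur_coeff_def truncate_schur_times_alternant)
  also have "\<dots> = (\<Sum>\<sigma> | \<sigma> permutes {..<l}.
      sign \<sigma> * scalar_product (complete_prod l (\<lambda>i. bracket lam i - bracket mu (\<sigma> i))) f)"
    using assms by (simp add: lookup_truncate_times_alternant_staircase_add scalar_product_complete_prod)
  also have "\<dots> = scalar_product (jacobi_trudi l lam mu) f"
    by (simp add: jacobi_trudi_expand additive.sum[OF additive_scalar_product(2)]
        additive_of_int_times[OF additive_scalar_product(2)])
  finally show ?thesis by simp
qed

theorem mainTheorem8:
  fixes lam mu :: composition and l :: nat
  assumes "lam \<in> partitions" and "mu \<in> partitions"
    and "\<And>i. part mu i \<le> part lam i"
    and "lam \<in> compositions_in l"
  shows "skew_schur lam mu = det (mat l l (\<lambda>(i, j). complete_h (bracket lam i - bracket mu j)))"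
proof -
  \<comment> \<open>Containment bounds the length of \<mu> by l, so both partitions fit into l
    variables.\<close>
  have "mu \<in> compositions_in l"
    using assms(3,4) by (auto simp: compositions_in_def) (metis le_zero_eq)
  then have "\<forall>f. scalar_product (jacobi_trudi l lam mu) f = scalar_product (schur lam) (schur mu * f)"
    using assms by (simp add: scalar_product_jacobi_trudi)
  then have "skew_schur lam mu = jacobi_trudi l lam mu"
    unfolding skew_schur_def by (intro the_equality) (auto intro: scalar_product_nondegenerate)
  then show ?thesis by (simp add: jacobi_trudi_def)
qed

end
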